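(* Let $f:\mathbb R^d\to\mathbb R$ be differentiable and let $\mathbf L=(L_1,\dots,L_d)$ be a nonnegative vector such that for all $\mathbf x,\mathbf y\in\mathbb R^d$, $f(\mathbf y)\le f(\mathbf x)+\langle\nabla f(\mathbf x),\mathbf y-\mathbf x\rangle+\frac12\sum_{i=1}^dL_i(y_i-x_i)^2$. Let $\mathcal Q$ be the finite codebook with scale-sharing groups $G$ described in the context, $s_i=s_G$ for $i\in G$, $L_G=\max_{i\in G}L_i$, and $f^*_{\mathcal Q}=\min_{\mathbf q\in\mathcal Q}f(\mathbf q)$. Suppose that at each endpoint $\mathbf q\in\mathcal Q$ the mini-batch gradient $\widehat{\mathbf g}(\mathbf q)$ satisfies $\mathbb E[\widehat{\mathbf g}(\mathbf q)\mid\mathbf q]=\nabla f(\mathbf q)$ and $\mathbb E[(\widehat g_i(\mathbf q)-\partial_if(\mathbf q))^2\mid\mathbf q]\le\sigma_i^2/n$ for each $i$, where $\boldsymbol\sigma=(\sigma_1,\dots,\sigma_d)\ge0$ and $n$ is the batch size; write $\boldsymbol\sigma_G=(\sigma_i)_{i\in G}$. Let $\gamma\ge0$, $\eta>0$, $T\ge1$. Run QAR-$\gamma$ (see context) from $\mathbf q_0\in\mathcal Q$ with stepsize $\eta$ and route $\mathbf u_t=\widehat{\mathbf g}(\mathbf q_t)$, and assume $\eta\,\widehat a_{t,i}b_{t,i}\le s_G$ almost surely for every $t<T$, every group $G$ and every $i\in G$. Then $$\frac1T\sum_{t=0}^{T-1}\mathbb E\|\mathbf g_{\mathcal Q}(\mathbf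 q_t)\|_2^2\le\frac{2(f(\mathbf q_0)-f^*_{\mathcal Q})}{\eta T}+\frac14\sum_G|G|L_G^2s_G^2+\frac1{\sqrt n}\sum_GL_Gs_G\|\boldsymbol\sigma_G\|_1+\frac{2\|\boldsymbol\sigma\|_2^2}{n}-\frac2T\sum_{t=0}^{T-1}\mathbb E\,\Delta_\gamma(\mathbf q_t),$$ where, for $\mathbf q\in\mathcal Q$, $$\Delta_\gamma(\mathbf q)=\mathbb E\Big[\sum_G\sum_{i\in G}(b_i-1)\Big(\widehat a_i^2-\tfrac12L_Gs_G\widehat a_i\Big)\,\Big|\,\mathbf q\Big]-\frac1{\sqrt n}\sum_G\Big(\mathbb E\Big[\sum_{i\in G}(b_i-1)^2\widehat a_i^2\,\Big|\,\mathbf q\Big]\Big)^{1/2}\|\boldsymbol\sigma_G\|_2,$$ with $\widehat a_i$, $b_i$ the feasible magnitudes and power scores computed from the sampled gradient $\widehat{\mathbf g}(\mathbf q)$ as in the context.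
   Context: Codebook: for each $i\in\{1,\dots,d\}$ let $\mathcal K_i=\{\underline k_i,\dots,\overline k_i\}\subset\mathbb Z$ with $\underline k_i\le\overline k_i$, let $s_i>0$, and $\mathcal Q=\{\mathbf q:\ q_i=s_ik_i,\ k_i\in\mathcal K_i\ \forall i\}$. The coordinates are partitioned into scale-sharing groups $G$, with $s_i=s_G$ for $i\in G$. Convention $\operatorname{sign}(0)=0$. Feasible endpoint gradient: for $\mathbf q\in\mathcal Q$ with $q_i=s_ik_i$ and $\mathbf g=\nabla f(\mathbf q)$, $(\mathbf g_{\mathcal Q}(\mathbf q))_i=g_i\,\mathbf 1\{k_i-\operatorname{sign}(g_i)\in\mathcal K_i\}$. Feasible magnitudes and scores: at $\mathbf q$ (code $\mathbf k$) with sampled gradient $\widehat{\mathbf g}$, $M_i=\mathbf 1\{k_i-\operatorname{sign}(\widehat g_i)\in\mathcal K_i\}$, $\widehat a_i=M_i|\widehat g_i|$, and for $i\in G$: $b_i=\widehat a_i^\gamma\big/\big(|G|^{-1}\sum_{j\in G}\widehat a_j^\gamma\big)$ if $\gamma>0$ and $\sum_{j\in G}\widehat a_j^\gamma>0$, and $b_i=1$ otherwise. Subscript $t$ denotes these quantities at step $t$ (at $\mathbf q_t$ with $\widehat{\mathbf g}_t=\widehat{\mathbf g}(\mathbf q_t)$). QAR-$\gamma$ step with route $\mathbf u_t=\widehat{\mathbf g}_t$: set $p_{t,i}=\min\{\eta\widehat a_{t,i}b_{t,i}/s_G,1\}$ for $i\in G$; given $(\mathbf q_t,\widehat{\mathbf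 g}_t)$, sample $J_{t,i}\sim\mathrm{Bernoulli}(p_{t,i})$ coordinatewise with fresh randomness; set $k_{t+1,i}=k_{t,i}-\operatorname{sign}(\widehat g_{t,i})J_{t,i}$ and $q_{t+1,i}=s_ik_{t+1,i}$. *)

theory Defs
  imports "HOL-Probability.Probability" "HOL-Library.Disjoint_Sets"
begin

text \<open>
  Coordinates are indexed by a finite type, codes are integer vectors, and the scale-sharing groups
  are the blocks of a partition \<open>\<G>\<close> of the index type. The scale is a function \<open>s\<close> on groups;
  the scale of a coordinate is that of its group.
\<close>

definition sign :: "real \<Rightarrow> int" where
  "sign x = (if x > 0 then 1 else if x < 0 then - 1 else 0)"

definition group_of :: "'d set set \<Rightarrow> 'd \<Rightarrow> 'd set" where
  "group_of \<G> i = (THE G. G \<in> \<G> \<and> i \<in> G)"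

definition codes :: "int^'d \<Rightarrow> int^'d \<Rightarrow> (int^'d) set" where
  "codes klo khi = {k. \<forall>i. k $ i \<in> {klo $ i..khi $ i}}"

definition decode :: "'d set set \<Rightarrow> ('d set \<Rightarrow> real) \<Rightarrow> int^'d \<Rightarrow> real^'d" where
  "decode \<G> s k = (\<chi> i. s (group_of \<G> i) * of_int (k $ i))"

definition codebook :: "int^'d \<Rightarrow> int^'d \<Rightarrow> 'd set set \<Rightarrow> ('d set \<Rightarrow> real) \<Rightarrow> (real^'d) set" where
  "codebook klo khi \<G> s = decode \<G> s ` codes klo khi"

definition feasible :: "int^'d \<Rightarrow> int^'d \<Rightarrow> int^'d \<Rightarrow> real^'d \<Rightarrow> 'd \<Rightarrow> bool" where
  "feasible klo khi k g i \<longleftrightarrow> k $ i - sign (g $ i) \<in> {klo $ i..khi $ i}"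

definition feasible_grad :: "int^'d \<Rightarrow> int^'d \<Rightarrow> int^'d \<Rightarrow> real^'d \<Rightarrow> real^'d" where
  "feasible_grad klo khi k g = (\<chi> i. g $ i * of_bool (feasible klo khi k g i))"

definition magnitude :: "int^'d \<Rightarrow> int^'d \<Rightarrow> int^'d \<Rightarrow> real^'d \<Rightarrow> real^'d" where
  "magnitude klo khi k g = (\<chi> i. of_bool (feasible klo khi k g i) * \<bar>g $ i\<bar>)"

definition score :: "'d set set \<Rightarrow> real \<Rightarrow> real^'d \<Rightarrow> real^'d" where
  "score \<G> \<gamma> a = (\<chi> i. let G = group_of \<G> i in
     if \<gamma> > 0 \<and> (\<Sum>j\<in>G. (a $ j) powr \<gamma>) > 0
     then (a $ i) powr \<gamma> / ((\<Sum>j\<in>G. (a $ j) powr \<gamma>) / real (card G))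
     else 1)"

definition move_prob ::
  "'d set set \<Rightarrow> ('d set \<Rightarrow> real) \<Rightarrow> real \<Rightarrow> real \<Rightarrow> real^'d \<Rightarrow> 'd \<Rightarrow> real" where
  "move_prob \<G> s \<gamma> \<eta> a i = min (\<eta> * a $ i * score \<G> \<gamma> a $ i / s (group_of \<G> i)) 1"

text \<open>
  The mini-batch gradient is a family \<open>\<nu>\<close> of distributions on gradient space, where
  \<open>\<nu> q\<close> is the law of the sampled gradient at the endpoint \<open>q\<close>; thus conditional expectations
  given the endpoint are integrals with respect to \<open>\<nu> q\<close>. Integrability is explicit because the
  Bochner integral of a non-integrable function is 0.
\<close>

definition minibatch_gradient ::
  "(real^'d) set \<Rightarrow> (real^'d \<Rightarrow> real^'d) \<Rightarrow> real^'d \<Rightarrow> nat \<Rightarrow> (real^'d \<Rightarrow> (real^'d) measure) \<Rightarrow> bool" where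
  "minibatch_gradient Q f' \<sigma> n \<nu> \<longleftrightarrow>
     (\<forall>q\<in>Q. prob_space (\<nu> q) \<and> sets (\<nu> q) = sets borel \<and>
        integrable (\<nu> q) (\<lambda>g. g) \<and> (LINT g|\<nu> q. g) = f' q \<and>
        (\<forall>i. integrable (\<nu> q) (\<lambda>g. (g $ i - f' q $ i)\<^sup>2) \<and>
             (LINT g|\<nu> q. (g $ i - f' q $ i)\<^sup>2) \<le> (\<sigma> $ i)\<^sup>2 / real n))"

text \<open>
  A run of length \<open>T\<close> on the space \<open>M\<close>: \<open>F t\<close> is the information available before the gradient at
  step \<open>t\<close> is sampled, and \<open>H t\<close> the information available once it has been. The gradient \<open>g t\<close> has
  conditional law \<open>\<nu> (q\<^sub>t)\<close> given \<open>F t\<close>. The indicators \<open>J t\<close> are, conditionally on \<open>H t\<close>,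
  independent Bernoulli variables whose parameters depend on the current code and gradient only;
  conditioning on all of \<open>H t\<close> is what makes their randomness fresh.
\<close>

definition qar_run ::
  "int^'d \<Rightarrow> int^'d \<Rightarrow> 'd::finite set set \<Rightarrow> ('d set \<Rightarrow> real) \<Rightarrow> (real^'d \<Rightarrow> (real^'d) measure) \<Rightarrow>
   real \<Rightarrow> real \<Rightarrow> int^'d \<Rightarrow> nat \<Rightarrow> 'w measure \<Rightarrow> (nat \<Rightarrow> 'w measure) \<Rightarrow> (nat \<Rightarrow> 'w measure) \<Rightarrow>
   (nat \<Rightarrow> 'w \<Rightarrow> int^'d) \<Rightarrow> (nat \<Rightarrow> 'w \<Rightarrow> real^'d) \<Rightarrow> (nat \<Rightarrow> 'w \<Rightarrow> 'd \<Rightarrow> bool) \<Rightarrow> bool" where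
  "qar_run klo khi \<G> s \<nu> \<gamma> \<eta> k0 T M F H k g J \<longleftrightarrow>
     prob_space M \<and>
     (\<forall>t\<le>T. subalgebra M (F t) \<and> k t \<in> F t \<rightarrow>\<^sub>M count_space UNIV) \<and>
     (\<forall>t<T. subalgebra M (H t) \<and> subalgebra (H t) (F t) \<and> subalgebra (F (Suc t)) (H t) \<and>
        g t \<in> H t \<rightarrow>\<^sub>M borel \<and> J t \<in> F (Suc t) \<rightarrow>\<^sub>M count_space UNIV) \<and>
     (\<forall>\<omega>\<in>space M. k 0 \<omega> = k0) \<and>
     (\<forall>t<T.
        (\<forall>A\<in>sets borel. AE \<omega> in M.
           real_cond_exp M (F t) (indicator {\<omega>\<in>space M. g t \<omega> \<in> A}) \<omega>
             = measure (\<nu> (decode \<G> s (k t \<omega>))) A) \<and>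
        (\<forall>c. AE \<omega> in M.
           real_cond_exp M (H t) (indicator {\<omega>\<in>space M. J t \<omega> = c}) \<omega>
             = pmf (Pi_pmf UNIV False (\<lambda>i. bernoulli_pmf
                 (move_prob \<G> s \<gamma> \<eta> (magnitude klo khi (k t \<omega>) (g t \<omega>)) i))) c) \<and>
        (\<forall>\<omega>\<in>space M. k (Suc t) \<omega> =
           (\<chi> i. k t \<omega> $ i - sign (g t \<omega> $ i) * of_bool (J t \<omega> i))))"

definition group_max :: "real^'d \<Rightarrow> 'd set \<Rightarrow> real" where
  "group_max L G = Max ((\<lambda>i. L $ i) ` G)"

definition route_gain ::
  "int^'d \<Rightarrow> int^'d \<Rightarrow> 'd::finite set set \<Rightarrow> ('d set \<Rightarrow> real) \<Rightarrow> (real^'d \<Rightarrow> (real^'d) measure) \<Rightarrow>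
   real \<Rightarrow> real^'d \<Rightarrow> real^'d \<Rightarrow> nat \<Rightarrow> int^'d \<Rightarrow> real" where
  "route_gain klo khi \<G> s \<nu> \<gamma> L \<sigma> n k =
     (let q = decode \<G> s k;
          a = magnitude klo khi k;
          b = (\<lambda>g. score \<G> \<gamma> (a g))
      in (LINT g|\<nu> q. (\<Sum>G\<in>\<G>. \<Sum>i\<in>G.
            (b g $ i - 1) * ((a g $ i)\<^sup>2 - 1 / 2 * group_max L G * s G * a g $ i)))
         - 1 / sqrt (real n) *
             (\<Sum>G\<in>\<G>. sqrt (LINT g|\<nu> q. (\<Sum>i\<in>G. (b g $ i - 1)\<^sup>2 * (a g $ i)\<^sup>2))
                * L2_set (\<lambda>i. \<sigma> $ i) G))"

end

theory Submission
  imports Defs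
begin

text \<open>
  Smoothness bounds \<open>f (q\<^sub>t\<^sub>+\<^sub>1)\<close> by \<open>f (q\<^sub>t)\<close> plus a linear combination of the Bernoulli indicators, since
  \<open>J\<^sup>2 = J\<close>. Without clipping the move probability is \<open>\<eta> a b / s\<close>, so averaging over the indicators
  leaves \<open>\<eta>\<close> times the drift \<open>\<Sum> b (\<Lambda> a / 2 - v y)\<close>, where \<open>v\<close> is the true gradient, \<open>y\<close> is the sampled
  gradient \<open>h\<close> with its infeasible coordinates set to zero, and \<open>\<Lambda> = L\<^sub>G s\<^sub>G\<close>. Writing \<open>b = 1 + (b - 1)\<close> and
  \<open>v = h - e\<close>, the part with \<open>b - 1\<close> is the route gain up to a cross term \<open>(b - 1) y e\<close>, handled by
  Cauchy--Schwarz on each group. For the remaining part, with \<open>u\<close> the feasible true gradient,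
  \<open>v y \<ge> u h - e\<^sup>2\<close> and \<open>a \<le> \<bar>u\<bar> + \<bar>e\<bar>\<close> hold pointwise: the feasibility of a coordinate differs
  between \<open>v\<close> and \<open>h\<close> only if the noise \<open>e\<close> is at least as large as both. The bound then telescopes.
\<close>

section \<open>Scale-sharing groups and power scores\<close>

lemma sum_sum_groups:
  fixes \<G> :: "'d::finite set set" and h :: "'d \<Rightarrow> real"
  assumes "partition_on UNIV \<G>"
  shows "(\<Sum>G\<in>\<G>. \<Sum>i\<in>G. h i) = (\<Sum>i\<in>UNIV. h i)"
proof -
  have "sum h (\<Union>\<G>) = (\<Sum>G\<in>\<G>. sum h G)"
    using partition_onD2[OF assms] by (subst sum.Union_disjoint) (auto simp: disjoint_def)
  then show ?thesis using partition_onD1[OF assms] by simp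
qed

lemma group_of_eq:
  assumes "partition_on UNIV \<G>" "G \<in> \<G>" "i \<in> G"
  shows "group_of \<G> i = G"
  unfolding group_of_def using assms partition_onD2[OF assms(1)]
  by (intro the_equality) (auto simp: disjoint_def)

lemma group_of_mem:
  assumes "partition_on UNIV \<G>"
  shows "group_of \<G> i \<in> \<G>" "i \<in> group_of \<G> i"
proof -
  obtain G where "G \<in> \<G>" "i \<in> G" using partition_onD1[OF assms] by auto
  then show "group_of \<G> i \<in> \<G>" "i \<in> group_of \<G> i" using group_of_eq[OF assms] by auto
qed

lemma coord_le_group_max:
  fixes G :: "'d::finite set"
  shows "i \<in> G \<Longrightarrow> L $ i \<le> group_max L G"
  unfolding group_max_def by (intro Max_ge) auto

lemma score_nonneg: "0 \<le> score \<G> \<gamma> a $ i"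
  by (auto simp: score_def Let_def intro!: divide_nonneg_nonneg sum_nonneg)

text \<open>A single power is at most the sum over its group, so the quotient is at most the size of
  the group. The resulting bound is uniform in the gradient, which makes multiplication by
  \<open>b - 1\<close> preserve integrability later on.\<close>

lemma score_le_card:
  fixes \<G> :: "'d::finite set set"
  assumes "partition_on UNIV \<G>"
  shows "score \<G> \<gamma> a $ i \<le> real CARD('d)"
proof -
  let ?G = "group_of \<G> i"
  let ?S = "\<Sum>j\<in>?G. (a $ j) powr \<gamma>"
  have "1 \<le> CARD('d)" by (simp add: Suc_leI)
  moreover have "(a $ i) powr \<gamma> / (?S / real (card ?G)) \<le> real CARD('d)" if "?S > 0"
  proof -
    have "(a $ i) powr \<gamma> \<le> ?S"
      by (rule member_le_sum) (use group_of_mem(2)[OF assms] in auto)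
    moreover have "real (card ?G) \<le> real CARD('d)" by (simp add: card_mono)
    ultimately have "(a $ i) powr \<gamma> * real (card ?G) \<le> ?S * real CARD('d)"
      by (intro mult_mono) (use that in auto)
    then show ?thesis using that by (simp add: divide_le_eq mult.commute)
  qed
  ultimately show ?thesis by (simp add: score_def Let_def)
qed

section \<open>Feasible magnitudes and their comparison with the true gradient\<close>

lemma magnitude_nonneg: "0 \<le> magnitude klo khi k h $ i"
  by (simp add: magnitude_def)

lemma magnitude_le: "magnitude klo khi k h $ i \<le> \<bar>h $ i\<bar>"
  by (simp add: magnitude_def)

lemma measurable_sign [measurable]: "(\<lambda>x. sign x) \<in> borel \<rightarrow>\<^sub>M count_space UNIV"
  unfolding sign_def by measurable

lemma borel_measurable_vec_nth [measurable]: "(\<lambda>h::real^'d::finite. h $ i) \<in> borel_measurable borel"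
  by (intro borel_measurable_continuous_onI continuous_intros)

lemma measurable_magnitude [measurable]:
  "(\<lambda>h. magnitude klo khi k h $ i) \<in> borel_measurable (borel :: (real^'d::finite) measure)"
proof -
  have "(\<lambda>h::real^'d. of_bool (k $ i - sign (h $ i) \<in> {klo $ i..khi $ i}) * \<bar>h $ i\<bar>)
      \<in> borel_measurable borel"
    unfolding of_bool_def by measurable
  then show ?thesis by (simp add: magnitude_def feasible_def)
qed

lemma measurable_score:
  fixes \<phi> :: "'a \<Rightarrow> real^'d::finite"
  assumes [measurable]: "\<And>i. (\<lambda>x. \<phi> x $ i) \<in> borel_measurable N"
  shows "(\<lambda>x. score \<G> \<gamma> (\<phi> x) $ i) \<in> borel_measurable N"
  unfolding score_def Let_def by simp

text \<open>If \<open>v $ i\<close> and \<open>h $ i\<close> have the same sign, they are feasible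
  together: the two products in the first bound then agree, and the second bound is the triangle
  inequality. Otherwise \<open>h $ i - v $ i\<close> is at least as large in absolute value as
  either entry, so its square absorbs the product and its absolute value absorbs the
  magnitude.\<close>

lemma
  fixes k :: "int^'d::finite" and v :: "real^'d" and i :: 'd
  assumes "k \<in> codes klo khi"
  defines "a \<equiv> \<lambda>h. magnitude klo khi k h $ i" and "u \<equiv> feasible_grad klo khi k v $ i"
  shows signed_magnitude_lower: "u * h $ i - (h $ i - v $ i)\<^sup>2 \<le> v $ i * (of_int (sign (h $ i)) * a h)"
    and magnitude_le_feasible_grad: "a h \<le> \<bar>u\<bar> + \<bar>h $ i - v $ i\<bar>"
proof -
  have k: "klo $ i \<le> k $ i" "k $ i \<le> khi $ i" using assms(1) by (auto simp: codes_def)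
  have opp: "\<bar>x * y\<bar> \<le> (x - y)\<^sup>2" if "x * y \<le> 0" for x y :: real
    using that zero_le_power2[of x] zero_le_power2[of y] unfolding power2_diff by linarith
  show "a h \<le> \<bar>u\<bar> + \<bar>h $ i - v $ i\<bar>"
    using k unfolding a_def u_def
    by (auto simp: magnitude_def feasible_grad_def feasible_def sign_def)
  have sq: "0 \<le> (h $ i - v $ i)\<^sup>2" by simp
  show "u * h $ i - (h $ i - v $ i)\<^sup>2 \<le> v $ i * (of_int (sign (h $ i)) * a h)"
  proof (cases "v $ i * h $ i > 0")
    case True
    then show ?thesis
      using k sq unfolding a_def u_def zero_less_mult_iff
      by (auto simp: magnitude_def feasible_grad_def feasible_def sign_def)
  next
    case False
    then have "\<bar>v $ i * h $ i\<bar> \<le> (h $ i - v $ i)\<^sup>2"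
      using opp[of "v $ i" "h $ i"] by (simp add: power2_commute)
    moreover have "u * h $ i \<le> 0" using False by (simp add: u_def feasible_grad_def)
    moreover have "- \<bar>v $ i * h $ i\<bar> \<le> v $ i * (of_int (sign (h $ i)) * a h)"
      by (auto simp: a_def magnitude_def sign_def)
    ultimately show ?thesis by linarith
  qed
qed

section \<open>Cauchy--Schwarz and the drift at a fixed code\<close>

lemma integral_sum_mult_le_sqrt:
  fixes u w :: "'i \<Rightarrow> 'a \<Rightarrow> real"
  assumes uw: "\<And>i. i \<in> I \<Longrightarrow> integrable N (\<lambda>x. u i x * w i x)"
    and u2: "\<And>i. i \<in> I \<Longrightarrow> integrable N (\<lambda>x. (u i x)\<^sup>2)"
    and w2: "\<And>i. i \<in> I \<Longrightarrow> integrable N (\<lambda>x. (w i x)\<^sup>2)"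
  shows "(LINT x|N. (\<Sum>i\<in>I. u i x * w i x))
    \<le> sqrt (LINT x|N. (\<Sum>i\<in>I. (u i x)\<^sup>2)) * sqrt (LINT x|N. (\<Sum>i\<in>I. (w i x)\<^sup>2))"
proof -
  define A B C where "A = (LINT x|N. (\<Sum>i\<in>I. (u i x)\<^sup>2))"
    and "B = (LINT x|N. (\<Sum>i\<in>I. (w i x)\<^sup>2))" and "C = (LINT x|N. (\<Sum>i\<in>I. u i x * w i x))"
  \<comment> \<open>The integral of the sum of the squares of \<open>t * u - w\<close> is
    nonnegative for every \<open>t\<close>. Cauchy--Schwarz, with the finite sum kept inside the
    integral, follows by choosing \<open>t\<close>.\<close>
  have quad: "0 \<le> t\<^sup>2 * A - 2 * t * C + B" for t
  proof -
    have "0 \<le> (LINT x|N. (\<Sum>i\<in>I. (t * u i x - w i x)\<^sup>2))"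
      by (intro integral_nonneg_AE) (simp add: sum_nonneg)
    also have "\<dots> = (LINT x|N. t\<^sup>2 * (\<Sum>i\<in>I. (u i x)\<^sup>2) - 2 * t * (\<Sum>i\<in>I. u i x * w i x) + (\<Sum>i\<in>I. (w i x)\<^sup>2))"
      by (simp add: power2_diff power_mult_distrib sum.distrib sum_subtractf sum_distrib_left mult.assoc
          algebra_simps)
    also have "\<dots> = t\<^sup>2 * A - 2 * t * C + B"
      unfolding A_def B_def C_def using uw u2 w2 by simp
    finally show ?thesis .
  qed
  have AB: "0 \<le> A" "0 \<le> B"
    unfolding A_def B_def by (intro integral_nonneg_AE; simp add: sum_nonneg)+
  have "C\<^sup>2 \<le> A * B"
  proof (cases "A = 0")
    case True
    \<comment> \<open>With \<open>A = 0\<close> the quadratic is \<open>B - 2 * t * C\<close>; if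
      \<open>C\<close> were nonzero, it would equal \<open>-1\<close> at this
      \<open>t\<close>.\<close>
    have "C = 0"
      using quad[of "(B + 1) / (2 * C)"] True by (cases "C = 0") (auto simp: field_simps)
    then show ?thesis using True by simp
  next
    case False
    \<comment> \<open>The minimiser \<open>C / A\<close> gives the value
      \<open>B - C^2 / A\<close>.\<close>
    then show ?thesis
      using quad[of "C / A"] AB by (simp add: power2_eq_square field_simps)
  qed
  then have "C \<le> sqrt (A * B)" by (rule real_le_rsqrt)
  then show ?thesis by (simp add: A_def B_def C_def real_sqrt_mult)
qed

lemma integrable_bounded_mult:
  fixes c \<phi> :: "'a \<Rightarrow> real"
  assumes "integrable N \<phi>" "c \<in> borel_measurable N" "\<And>x. \<bar>c x\<bar> \<le> B"
  shows "integrable N (\<lambda>x. c x * \<phi> x)"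
proof (rule Bochner_Integration.integrable_bound)
  show "integrable N (\<lambda>x. B * \<phi> x)" using assms(1) by simp
  show "(\<lambda>x. c x * \<phi> x) \<in> borel_measurable N" using assms by simp
  have "0 \<le> B" using assms(3) abs_ge_zero order_trans by blast
  then show "AE x in N. norm (c x * \<phi> x) \<le> norm (B * \<phi> x)"
    using assms(3) by (auto simp: abs_mult intro!: mult_right_mono)
qed

text \<open>Without clipping, the integrand times \<eta> bounds the change of \<open>f\<close> once
  the indicators have been averaged out. What remains is the expectation over the gradient at one
  fixed code, so that \<open>N\<close> and \<open>v\<close> are constant. The constants are half of
  the final ones because the gradient norm appears here with factor \<open>1 / 2\<close>.\<close>

lemma route_drift_le:
  fixes k :: "int^'d::finite" and \<G> :: "'d set set" and s :: "'d set \<Rightarrow> real"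
  assumes minibatch: "minibatch_gradient (codebook klo khi \<G> s) f' \<sigma> n \<nu>"
    and k: "k \<in> codes klo khi"
    and groups: "partition_on UNIV \<G>"
    and scale_pos: "\<And>G. G \<in> \<G> \<Longrightarrow> s G > 0"
    and L_nonneg: "\<And>i. L $ i \<ge> 0"
    and sigma_nonneg: "\<And>i. \<sigma> $ i \<ge> 0"
    and n: "n \<ge> 1"
  defines "N \<equiv> \<nu> (decode \<G> s k)" and "v \<equiv> f' (decode \<G> s k)"
    and "\<Lambda> \<equiv> \<lambda>G. group_max L G * s G"
    and "a \<equiv> magnitude klo khi k"
  shows "integrable N (\<lambda>h. \<Sum>G\<in>\<G>. \<Sum>i\<in>G. score \<G> \<gamma> (a h) $ i *
           (\<Lambda> G / 2 * a h $ i - v $ i * (of_int (sign (h $ i)) * a h $ i)))" (is ?int)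
    and "(LINT h|N. (\<Sum>G\<in>\<G>. \<Sum>i\<in>G. score \<G> \<gamma> (a h) $ i *
           (\<Lambda> G / 2 * a h $ i - v $ i * (of_int (sign (h $ i)) * a h $ i))))
      \<le> 1 / 8 * (\<Sum>G\<in>\<G>. real (card G) * (\<Lambda> G)\<^sup>2)
        + 1 / (2 * sqrt (real n)) * (\<Sum>G\<in>\<G>. \<Lambda> G * (\<Sum>i\<in>G. \<bar>\<sigma> $ i\<bar>))
        + (norm \<sigma>)\<^sup>2 / real n
        - 1 / 2 * (norm (feasible_grad klo khi k v))\<^sup>2
        - route_gain klo khi \<G> s \<nu> \<gamma> L \<sigma> n k" (is ?le)
proof -
  have "decode \<G> s k \<in> codebook klo khi \<G> s" using k by (simp add: codebook_def)
  then have N: "prob_space N" "sets N = sets borel" "integrable N (\<lambda>h. h)" "(LINT h|N. h) = v"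
    and var_int: "\<And>i. integrable N (\<lambda>h. (h $ i - v $ i)\<^sup>2)"
    and var_le: "\<And>i. (LINT h|N. (h $ i - v $ i)\<^sup>2) \<le> (\<sigma> $ i)\<^sup>2 / real n"
    using minibatch unfolding minibatch_gradient_def N_def v_def by auto
  interpret prob_space N by fact
  note [measurable_cong] = N(2)
  define y where "y = (\<lambda>h i. of_int (sign (h $ i)) * a h $ i)"
  define b where "b = (\<lambda>h i. score \<G> \<gamma> (a h) $ i)"
  define e where "e = (\<lambda>h i. h $ i - v $ i)"
  define u where "u = feasible_grad klo khi k v"
  \<comment> \<open>\<open>\<tau> i\<close> bounds the standard deviation of coordinate
    \<open>i\<close>.\<close>
  define \<tau> where "\<tau> = (\<lambda>i. \<sigma> $ i / sqrt (real n))"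
  have a_meas [measurable]: "(\<lambda>h. a h $ i) \<in> borel_measurable N" for i
    unfolding a_def by measurable
  have y_meas [measurable]: "(\<lambda>h. y h i) \<in> borel_measurable N" for i
    unfolding y_def by measurable
  have b_meas [measurable]: "(\<lambda>h. b h i) \<in> borel_measurable N" for i
    unfolding b_def by (rule measurable_score) simp
  have e_meas [measurable]: "(\<lambda>h. e h i) \<in> borel_measurable N" for i
    unfolding e_def by measurable
  have a_nn: "0 \<le> a h $ i" for h i unfolding a_def by (rule magnitude_nonneg)
  have a_le: "a h $ i \<le> \<bar>h $ i\<bar>" for h i unfolding a_def by (rule magnitude_le)
  have abs_y: "\<bar>y h i\<bar> \<le> a h $ i" for h i using a_nn[of h i] by (simp add: y_def sign_def)
  have y_h: "y h i * h $ i = (a h $ i)\<^sup>2" for h i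
    unfolding y_def a_def by (auto simp: magnitude_def sign_def power2_eq_square)
  have y2: "(y h i)\<^sup>2 = (a h $ i)\<^sup>2" for h i
    unfolding y_def a_def by (auto simp: magnitude_def sign_def power2_eq_square)
  have b_bound: "\<bar>b h i - 1\<bar> \<le> real CARD('d) + 1" for h i
    using score_nonneg[of \<G> \<gamma> "a h" i] score_le_card[OF groups, of \<gamma> "a h" i] by (simp add: b_def)
  have h_int: "integrable N (\<lambda>h. h $ i)" and h_mean: "(LINT h|N. h $ i) = v $ i" for i
    using integrable_bounded_linear[OF bounded_linear_vec_nth N(3), of i]
      integral_bounded_linear[OF bounded_linear_vec_nth N(3), of i] N(4) by auto
  have e_int: "integrable N (\<lambda>h. e h i)" for i unfolding e_def using h_int by simp
  have e2_int: "integrable N (\<lambda>h. (e h i)\<^sup>2)" for i unfolding e_def by (rule var_int)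
  have a_int: "integrable N (\<lambda>h. a h $ i)" for i
    by (rule Bochner_Integration.integrable_bound[OF h_int[of i]]) (use a_nn a_le in auto)
  have y_int: "integrable N (\<lambda>h. y h i)" for i
    by (rule Bochner_Integration.integrable_bound[OF a_int[of i]])
       (use a_nn abs_y in \<open>auto simp: abs_of_nonneg\<close>)
  have h2_int: "integrable N (\<lambda>h. (h $ i)\<^sup>2)" for i
  proof -
    \<comment> \<open>The assumption controls only the second moment of the noise; expanding
      \<open>h = v + e\<close> transfers it to \<open>h\<close>.\<close>
    have "integrable N (\<lambda>h. (e h i)\<^sup>2 + 2 * v $ i * e h i + (v $ i)\<^sup>2)"
      using e2_int e_int by simp
    then show ?thesis by (simp add: e_def power2_eq_square algebra_simps)
  qed
  have a2_int: "integrable N (\<lambda>h. (a h $ i)\<^sup>2)" for i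
    by (rule Bochner_Integration.integrable_bound[OF h2_int[of i]])
       (use a_nn a_le in \<open>auto simp: abs_le_square_iff[symmetric]\<close>)
  have ey_int: "integrable N (\<lambda>h. e h i * y h i)" for i
  proof -
    \<comment> \<open>Since \<open>y * h = a\<^sup>2\<close>, the product \<open>e * y\<close> is a
      combination of functions already known to be integrable.\<close>
    have "integrable N (\<lambda>h. (a h $ i)\<^sup>2 - v $ i * y h i)" using a2_int y_int by simp
    then show ?thesis by (simp add: e_def y_h[symmetric] algebra_simps)
  qed
  have b_mult: "integrable N (\<lambda>h. (b h i - 1) * \<phi> h)" if "integrable N \<phi>" for \<phi> i
    by (rule integrable_bounded_mult[OF that _ b_bound]) simp
  have cross_int: "integrable N (\<lambda>h. (b h i - 1) * y h i * e h i)" for i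
    using b_mult[OF ey_int[of i], of i] by (simp add: mult_ac)
  have spread_int: "integrable N (\<lambda>h. ((b h i - 1) * y h i)\<^sup>2)" for i
    using b_mult[OF b_mult[OF a2_int[of i], of i], of i]
    by (simp add: power_mult_distrib y2) (simp add: power2_eq_square mult_ac)
  have gain_int: "integrable N (\<lambda>h. (b h i - 1) * ((a h $ i)\<^sup>2 - l / 2 * a h $ i))" for i l
    by (rule b_mult) (use a2_int a_int in simp)
  have base_int: "integrable N (\<lambda>h. l / 2 * a h $ i - v $ i * y h i)" for i l
    using a_int y_int by simp
  \<comment> \<open>Substituting \<open>v * y = a\<^sup>2 - e * y\<close> in the part with factor
    \<open>b - 1\<close> yields minus the integrand of the route gain, plus a term that is linear in
    the noise.\<close>
  have split: "b h i * (l / 2 * a h $ i - v $ i * y h i)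
      = (l / 2 * a h $ i - v $ i * y h i) - (b h i - 1) * ((a h $ i)\<^sup>2 - l / 2 * a h $ i)
        + (b h i - 1) * y h i * e h i" for h i l
    by (simp add: e_def y_h[symmetric] field_simps)
  have drift_int: "integrable N (\<lambda>h. b h i * (l / 2 * a h $ i - v $ i * y h i))" for i l
    unfolding split
    by (rule Bochner_Integration.integrable_add[OF Bochner_Integration.integrable_diff[OF base_int gain_int] cross_int])
  have drift_eq: "(LINT h|N. b h i * (l / 2 * a h $ i - v $ i * y h i))
      = (LINT h|N. l / 2 * a h $ i - v $ i * y h i)
        - (LINT h|N. (b h i - 1) * ((a h $ i)\<^sup>2 - l / 2 * a h $ i))
        + (LINT h|N. (b h i - 1) * y h i * e h i)" for i l
    unfolding split
    by (simp only: Bochner_Integration.integral_add Bochner_Integration.integral_diff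
        Bochner_Integration.integrable_diff base_int gain_int cross_int)
  have \<tau>: "0 \<le> \<tau> i" "(\<tau> i)\<^sup>2 = (\<sigma> $ i)\<^sup>2 / real n" for i
    using sigma_nonneg n by (auto simp: \<tau>_def power_divide)
  have e2_le: "(LINT h|N. (e h i)\<^sup>2) \<le> (\<tau> i)\<^sup>2" for i unfolding e_def \<tau> by (rule var_le)
  have abs_e_le: "(LINT h|N. \<bar>e h i\<bar>) \<le> \<tau> i" for i
  proof (rule power2_le_imp_le)
    \<comment> \<open>The variance of the absolute noise is nonnegative, so its squared mean is at
      most its second moment.\<close>
    have "(LINT h|N. \<bar>e h i\<bar>)\<^sup>2 \<le> (LINT h|N. (e h i)\<^sup>2)"
      using variance_eq[of "\<lambda>h. \<bar>e h i\<bar>"] variance_positive[of "\<lambda>h. \<bar>e h i\<bar>"] e_int e2_int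
      by simp
    then show "(LINT h|N. \<bar>e h i\<bar>)\<^sup>2 \<le> (\<tau> i)\<^sup>2" using e2_le[of i] by linarith
  qed (rule \<tau>)
  have base_le: "(LINT h|N. l / 2 * a h $ i - v $ i * y h i)
      \<le> l\<^sup>2 / 8 + l * \<tau> i / 2 + (\<tau> i)\<^sup>2 - (u $ i)\<^sup>2 / 2" if "0 \<le> l" for l i
  proof -
    have "(LINT h|N. l / 2 * a h $ i - v $ i * y h i)
        \<le> (LINT h|N. l / 2 * (\<bar>u $ i\<bar> + \<bar>e h i\<bar>) - (u $ i * h $ i - (e h i)\<^sup>2))"
    proof (rule integral_mono[OF base_int])
      show "integrable N (\<lambda>h. l / 2 * (\<bar>u $ i\<bar> + \<bar>e h i\<bar>) - (u $ i * h $ i - (e h i)\<^sup>2))"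
        using e_int e2_int h_int by simp
      show "l / 2 * a h $ i - v $ i * y h i
          \<le> l / 2 * (\<bar>u $ i\<bar> + \<bar>e h i\<bar>) - (u $ i * h $ i - (e h i)\<^sup>2)" for h
      proof (rule diff_mono)
        show "l / 2 * a h $ i \<le> l / 2 * (\<bar>u $ i\<bar> + \<bar>e h i\<bar>)"
          using magnitude_le_feasible_grad[OF k, of h i v] that
          unfolding a_def u_def e_def by (intro mult_left_mono) auto
        show "u $ i * h $ i - (e h i)\<^sup>2 \<le> v $ i * y h i"
          using signed_magnitude_lower[OF k] unfolding a_def u_def e_def y_def .
      qed
    qed
    also have "\<dots> = l / 2 * (\<bar>u $ i\<bar> + (LINT h|N. \<bar>e h i\<bar>)) - (u $ i * v $ i - (LINT h|N. (e h i)\<^sup>2))"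
      using e_int e2_int h_int by (simp add: h_mean prob_space)
    \<comment> \<open>Each entry of \<open>u\<close> is either the entry of \<open>v\<close> or 0.
      The factor \<open>v\<close> here is the mean of \<open>h\<close>: unbiasedness produces the
      squared feasible gradient.\<close>
    also have "u $ i * v $ i = (u $ i)\<^sup>2"
      by (simp add: u_def feasible_grad_def power2_eq_square)
    also have "l / 2 * (\<bar>u $ i\<bar> + (LINT h|N. \<bar>e h i\<bar>)) - ((u $ i)\<^sup>2 - (LINT h|N. (e h i)\<^sup>2))
        \<le> l / 2 * (\<bar>u $ i\<bar> + \<tau> i) - ((u $ i)\<^sup>2 - (\<tau> i)\<^sup>2)"
      using abs_e_le e2_le that by (intro diff_mono mult_left_mono add_mono) auto
    \<comment> \<open>Half of \<open>(u $ i)\<^sup>2\<close> is spent on the term linear in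
      \<open>\<bar>u $ i\<bar>\<close>, by completing the square; the cost is
      \<open>l\<^sup>2 / 8\<close>, the origin of the constant \<open>1 / 8\<close>.\<close>
    also have "\<dots> \<le> l\<^sup>2 / 8 + l * \<tau> i / 2 + (\<tau> i)\<^sup>2 - (u $ i)\<^sup>2 / 2"
      using zero_le_power2[of "\<bar>u $ i\<bar> - l / 2"]
      by (simp add: power2_eq_square algebra_simps)
    finally show ?thesis .
  qed
  have group: "(LINT h|N. (\<Sum>i\<in>G. b h i * (\<Lambda> G / 2 * a h $ i - v $ i * y h i)))
      \<le> (\<Sum>i\<in>G. (\<Lambda> G)\<^sup>2 / 8 + \<Lambda> G * \<tau> i / 2 + (\<tau> i)\<^sup>2 - (u $ i)\<^sup>2 / 2)
        - (LINT h|N. (\<Sum>i\<in>G. (b h i - 1) * ((a h $ i)\<^sup>2 - \<Lambda> G / 2 * a h $ i)))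
        + sqrt (LINT h|N. (\<Sum>i\<in>G. (b h i - 1)\<^sup>2 * (a h $ i)\<^sup>2)) * (L2_set (\<lambda>i. \<sigma> $ i) G / sqrt (real n))"
    if G: "G \<in> \<G>" for G
  proof -
    \<comment> \<open>Blocks of a partition are nonempty, so the group maximum dominates some
      nonnegative entry of \<open>L\<close>.\<close>
    obtain i where "i \<in> G" using partition_onD3[OF groups] G by fastforce
    then have "0 \<le> \<Lambda> G"
      using coord_le_group_max[of i G L] L_nonneg[of i] scale_pos[OF G] by (simp add: \<Lambda>_def)
    note base = base_le[OF this]
    have "(LINT h|N. (\<Sum>i\<in>G. b h i * (\<Lambda> G / 2 * a h $ i - v $ i * y h i)))
      = (\<Sum>i\<in>G. LINT h|N. \<Lambda> G / 2 * a h $ i - v $ i * y h i)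
        - (LINT h|N. (\<Sum>i\<in>G. (b h i - 1) * ((a h $ i)\<^sup>2 - \<Lambda> G / 2 * a h $ i)))
        + (LINT h|N. (\<Sum>i\<in>G. (b h i - 1) * y h i * e h i))"
      by (simp only: Bochner_Integration.integral_sum drift_int gain_int cross_int drift_eq
          sum.distrib sum_subtractf)
    moreover have "(\<Sum>i\<in>G. LINT h|N. \<Lambda> G / 2 * a h $ i - v $ i * y h i)
        \<le> (\<Sum>i\<in>G. (\<Lambda> G)\<^sup>2 / 8 + \<Lambda> G * \<tau> i / 2 + (\<tau> i)\<^sup>2 - (u $ i)\<^sup>2 / 2)"
      by (intro sum_mono base)
    moreover have "(LINT h|N. (\<Sum>i\<in>G. (b h i - 1) * y h i * e h i))
        \<le> sqrt (LINT h|N. (\<Sum>i\<in>G. (b h i - 1)\<^sup>2 * (a h $ i)\<^sup>2)) * (L2_set (\<lambda>i. \<sigma> $ i) G / sqrt (real n))"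
    proof -
      have "(LINT h|N. (\<Sum>i\<in>G. (b h i - 1) * y h i * e h i))
        \<le> sqrt (LINT h|N. (\<Sum>i\<in>G. ((b h i - 1) * y h i)\<^sup>2)) * sqrt (LINT h|N. (\<Sum>i\<in>G. (e h i)\<^sup>2))"
        by (intro integral_sum_mult_le_sqrt cross_int spread_int e2_int)
      also have "\<dots> \<le> sqrt (LINT h|N. (\<Sum>i\<in>G. ((b h i - 1) * y h i)\<^sup>2)) * sqrt (\<Sum>i\<in>G. (\<tau> i)\<^sup>2)"
      proof (intro mult_left_mono real_sqrt_le_mono)
        show "(LINT h|N. (\<Sum>i\<in>G. (e h i)\<^sup>2)) \<le> (\<Sum>i\<in>G. (\<tau> i)\<^sup>2)"
          using e2_int e2_le by (simp add: sum_mono)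
        show "0 \<le> sqrt (LINT h|N. (\<Sum>i\<in>G. ((b h i - 1) * y h i)\<^sup>2))"
          by (intro real_sqrt_ge_zero integral_nonneg_AE) (simp add: sum_nonneg)
      qed
      also have "sqrt (\<Sum>i\<in>G. (\<tau> i)\<^sup>2) = L2_set (\<lambda>i. \<sigma> $ i) G / sqrt (real n)"
        by (simp add: \<tau> L2_set_def sum_divide_distrib[symmetric] real_sqrt_divide)
      finally show ?thesis by (simp add: power_mult_distrib y2)
    qed
    ultimately show ?thesis by linarith
  qed
  show ?int
    using drift_int unfolding b_def y_def by (intro Bochner_Integration.integrable_sum)
  have "(LINT h|N. (\<Sum>G\<in>\<G>. \<Sum>i\<in>G. b h i * (\<Lambda> G / 2 * a h $ i - v $ i * y h i)))
      = (\<Sum>G\<in>\<G>. LINT h|N. (\<Sum>i\<in>G. b h i * (\<Lambda> G / 2 * a h $ i - v $ i * y h i)))"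
    by (intro Bochner_Integration.integral_sum Bochner_Integration.integrable_sum drift_int)
  also have "\<dots> \<le> (\<Sum>G\<in>\<G>. (\<Sum>i\<in>G. (\<Lambda> G)\<^sup>2 / 8 + \<Lambda> G * \<tau> i / 2 + (\<tau> i)\<^sup>2 - (u $ i)\<^sup>2 / 2)
        - (LINT h|N. (\<Sum>i\<in>G. (b h i - 1) * ((a h $ i)\<^sup>2 - \<Lambda> G / 2 * a h $ i)))
        + sqrt (LINT h|N. (\<Sum>i\<in>G. (b h i - 1)\<^sup>2 * (a h $ i)\<^sup>2)) * (L2_set (\<lambda>i. \<sigma> $ i) G / sqrt (real n)))"
    by (intro sum_mono group)
  also have "\<dots> = (\<Sum>G\<in>\<G>. \<Sum>i\<in>G. (\<Lambda> G)\<^sup>2 / 8 + \<Lambda> G * \<tau> i / 2 + (\<tau> i)\<^sup>2 - (u $ i)\<^sup>2 / 2)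
        - (\<Sum>G\<in>\<G>. LINT h|N. (\<Sum>i\<in>G. (b h i - 1) * ((a h $ i)\<^sup>2 - \<Lambda> G / 2 * a h $ i)))
        + (\<Sum>G\<in>\<G>. sqrt (LINT h|N. (\<Sum>i\<in>G. (b h i - 1)\<^sup>2 * (a h $ i)\<^sup>2)) * (L2_set (\<lambda>i. \<sigma> $ i) G / sqrt (real n)))"
    by (simp add: sum.distrib sum_subtractf)
  also have "\<dots> = (\<Sum>G\<in>\<G>. \<Sum>i\<in>G. (\<Lambda> G)\<^sup>2 / 8 + \<Lambda> G * \<tau> i / 2 + (\<tau> i)\<^sup>2 - (u $ i)\<^sup>2 / 2)
        - route_gain klo khi \<G> s \<nu> \<gamma> L \<sigma> n k"
  proof -
    have "(LINT h|N. (\<Sum>G\<in>\<G>. \<Sum>i\<in>G. (b h i - 1) * ((a h $ i)\<^sup>2 - \<Lambda> G / 2 * a h $ i)))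
        = (\<Sum>G\<in>\<G>. LINT h|N. (\<Sum>i\<in>G. (b h i - 1) * ((a h $ i)\<^sup>2 - \<Lambda> G / 2 * a h $ i)))"
      by (intro Bochner_Integration.integral_sum Bochner_Integration.integrable_sum gain_int)
    then show ?thesis
      unfolding route_gain_def Let_def N_def[symmetric] a_def[symmetric] b_def \<Lambda>_def
      by (simp add: sum_distrib_left)
  qed
  also have "(\<Sum>G\<in>\<G>. \<Sum>i\<in>G. (\<Lambda> G)\<^sup>2 / 8 + \<Lambda> G * \<tau> i / 2 + (\<tau> i)\<^sup>2 - (u $ i)\<^sup>2 / 2)
      = 1 / 8 * (\<Sum>G\<in>\<G>. real (card G) * (\<Lambda> G)\<^sup>2)
        + 1 / (2 * sqrt (real n)) * (\<Sum>G\<in>\<G>. \<Lambda> G * (\<Sum>i\<in>G. \<bar>\<sigma> $ i\<bar>))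
        + (\<Sum>G\<in>\<G>. \<Sum>i\<in>G. (\<tau> i)\<^sup>2) - 1 / 2 * (\<Sum>G\<in>\<G>. \<Sum>i\<in>G. (u $ i)\<^sup>2)"
    using sigma_nonneg
    by (simp add: sum.distrib sum_subtractf sum_distrib_left sum_divide_distrib \<tau>_def mult_ac)
  also have "(\<Sum>G\<in>\<G>. \<Sum>i\<in>G. (\<tau> i)\<^sup>2) = (norm \<sigma>)\<^sup>2 / real n"
    unfolding sum_sum_groups[OF groups]
    by (simp add: \<tau> norm_vec_def L2_set_def sum_nonneg sum_divide_distrib)
  also have "(\<Sum>G\<in>\<G>. \<Sum>i\<in>G. (u $ i)\<^sup>2) = (norm u)\<^sup>2"
    unfolding sum_sum_groups[OF groups] by (simp add: norm_vec_def L2_set_def sum_nonneg)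
  finally show ?le unfolding b_def y_def u_def .
qed

section \<open>Finitely many codes, and expectations under the conditional laws\<close>

lemma finite_codes: "finite (codes klo khi :: (int^'d::finite) set)"
proof (rule finite_subset)
  show "codes klo khi \<subseteq> vec_lambda ` (\<Pi>\<^sub>E i\<in>UNIV. {klo $ i..khi $ i})"
    by (auto simp: codes_def image_iff PiE_def Pi_def intro!: exI[of _ "vec_nth _"])
  show "finite (vec_lambda ` (\<Pi>\<^sub>E i\<in>(UNIV :: 'd set). {klo $ i..khi $ i}))"
    by (intro finite_imageI finite_PiE) auto
qed

text \<open>Every function of the code is measurable by countability, and almost surely bounded by
  the sum of its absolute values over the finite set. This makes the objective, the squared feasible
  gradient and the route gain integrable along a run.\<close>

lemma (in prob_space) integrable_finite_valued:
  fixes \<psi> :: "'k::countable \<Rightarrow> real"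
  assumes K: "K \<in> M \<rightarrow>\<^sub>M count_space UNIV" and AE: "AE \<omega> in M. K \<omega> \<in> S" and S: "finite S"
  shows "integrable M (\<lambda>\<omega>. \<psi> (K \<omega>))"
proof (rule integrable_const_bound)
  show "AE \<omega> in M. norm (\<psi> (K \<omega>)) \<le> (\<Sum>\<kappa>\<in>S. \<bar>\<psi> \<kappa>\<bar>)"
    using AE by eventually_elim (auto intro!: member_le_sum[of _ S "\<lambda>\<kappa>. \<bar>\<psi> \<kappa>\<bar>"] simp: S)
  show "(\<lambda>\<omega>. \<psi> (K \<omega>)) \<in> borel_measurable M" using K by measurable
qed

text \<open>On the event that \<open>K\<close> equals \<kappa> the kernel is the single measure
  \<open>N \<kappa>\<close>. The law holds for each set \<open>A\<close> outside a null set that may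
  depend on \<open>A\<close>; integrating over the event first removes these null sets, and only
  then are the two measures compared on all sets of \<open>X\<close>. Summing over the finitely many
  codes later recovers the full expectation.\<close>

lemma (in prob_space)
  fixes \<phi> :: "'x \<Rightarrow> real"
  assumes sub: "subalgebra M F"
    and K: "K \<in> F \<rightarrow>\<^sub>M count_space UNIV"
    and g [measurable]: "g \<in> M \<rightarrow>\<^sub>M X"
    and law: "\<And>A. A \<in> sets X \<Longrightarrow> AE \<omega> in M.
      real_cond_exp M F (indicator {\<omega>\<in>space M. g \<omega> \<in> A}) \<omega> = measure (N (K \<omega>)) A"
    and N: "prob_space (N \<kappa>)" "sets (N \<kappa>) = sets X"
    and \<phi>: "integrable (N \<kappa>) \<phi>"
  shows integrable_on_fibre:
      "integrable M (\<lambda>\<omega>. indicator {\<omega>\<in>space M. K \<omega> = \<kappa>} \<omega> * \<phi> (g \<omega>))"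
    and integral_on_fibre:
      "(LINT \<omega>|M. indicator {\<omega>\<in>space M. K \<omega> = \<kappa>} \<omega> * \<phi> (g \<omega>))
        = prob {\<omega>\<in>space M. K \<omega> = \<kappa>} * (LINT h|N \<kappa>. \<phi> h)"
proof -
  interpret N: prob_space "N \<kappa>" by fact
  interpret F: finite_measure_subalgebra M F using sub by unfold_locales
  define E where "E = {\<omega>\<in>space M. K \<omega> = \<kappa>}"
  have spaceF: "space F = space M" using sub by (simp add: subalgebra_def)
  have EF [measurable]: "E \<in> sets F"
    using measurable_sets[OF K, of "{\<kappa>}"] by (simp add: E_def vimage_def Int_def spaceF conj_commute)
  then have EM [measurable]: "E \<in> sets M" using sub by (auto simp: subalgebra_def)
  have [measurable]: "\<phi> \<in> borel_measurable X"
    using \<phi> measurable_cong_sets[OF N(2) refl] by (auto dest: borel_measurable_integrable)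
  \<comment> \<open>The law of \<open>g\<close> on the event is left unnormalised, so an event of
    probability 0 needs no separate treatment.\<close>
  have eq: "distr (density M (\<lambda>\<omega>. ennreal (indicator E \<omega>))) X g = density (N \<kappa>) (\<lambda>_. ennreal (prob E))"
  proof (rule measure_eqI)
    fix A assume "A \<in> sets (distr (density M (\<lambda>\<omega>. ennreal (indicator E \<omega>))) X g)"
    then have A [measurable]: "A \<in> sets X" by simp
    define B where "B = {\<omega>\<in>space M. g \<omega> \<in> A}"
    have B [measurable]: "B \<in> sets M" unfolding B_def by measurable
    have "prob (E \<inter> B) = (LINT \<omega>|M. indicator E \<omega> * indicator B \<omega>)"
      using EM B by (simp add: indicator_inter_arith[symmetric])
    also have "\<dots> = (LINT \<omega>|M. indicator E \<omega> * real_cond_exp M F (indicator B) \<omega>)"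
      by (rule F.real_cond_exp_intg(2)[symmetric])
         (use EM B in \<open>auto simp: indicator_inter_arith[symmetric] less_top[symmetric]\<close>)
    also have "\<dots> = (LINT \<omega>|M. indicator E \<omega> * measure (N \<kappa>) A)"
    proof (rule integral_cong_AE)
      show "AE \<omega> in M. indicator E \<omega> * real_cond_exp M F (indicator B) \<omega> = indicator E \<omega> * measure (N \<kappa>) A"
        using law[OF A] unfolding B_def[symmetric]
        by eventually_elim (auto simp: E_def indicator_def)
    qed (use measurable_from_subalg[OF sub borel_measurable_cond_exp] in measurable)
    also have "\<dots> = prob E * measure (N \<kappa>) A" by simp
    finally have "prob (E \<inter> B) = prob E * measure (N \<kappa>) A" .
    moreover have "emeasure (distr (density M (\<lambda>\<omega>. ennreal (indicator E \<omega>))) X g) A = emeasure M (E \<inter> B)"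
    proof -
      have "g -` A \<inter> space M = B" by (auto simp: B_def)
      then show ?thesis
        by (simp add: emeasure_distr emeasure_density ennreal_indicator indicator_inter_arith[symmetric])
    qed
    moreover have "emeasure (density (N \<kappa>) (\<lambda>_. ennreal (prob E))) A = ennreal (prob E) * emeasure (N \<kappa>) A"
      using A N(2) by (simp add: emeasure_density_const)
    ultimately show "emeasure (distr (density M (\<lambda>\<omega>. ennreal (indicator E \<omega>))) X g) A
        = emeasure (density (N \<kappa>) (\<lambda>_. ennreal (prob E))) A"
      by (simp add: emeasure_eq_measure N.emeasure_eq_measure ennreal_mult)
  qed (simp add: N(2))
  have "integrable (density (N \<kappa>) (\<lambda>_. ennreal (prob E))) \<phi>"
    using \<phi> by (subst integrable_density) auto
  then have "integrable M (\<lambda>\<omega>. indicator E \<omega> * \<phi> (g \<omega>))"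
    unfolding eq[symmetric] by (subst (asm) integrable_distr_eq; simp add: integrable_density)
  then show "integrable M (\<lambda>\<omega>. indicator {\<omega>\<in>space M. K \<omega> = \<kappa>} \<omega> * \<phi> (g \<omega>))"
    by (simp add: E_def)
  have "(LINT \<omega>|M. indicator E \<omega> * \<phi> (g \<omega>))
      = integral\<^sup>L (distr (density M (\<lambda>\<omega>. ennreal (indicator E \<omega>))) X g) \<phi>"
    by (simp add: integral_distr integral_density)
  also have "\<dots> = prob E * (LINT h|N \<kappa>. \<phi> h)"
    unfolding eq using \<phi> by (subst integral_density) auto
  finally show "(LINT \<omega>|M. indicator {\<omega>\<in>space M. K \<omega> = \<kappa>} \<omega> * \<phi> (g \<omega>))
        = prob {\<omega>\<in>space M. K \<omega> = \<kappa>} * (LINT h|N \<kappa>. \<phi> h)"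
    by (simp add: E_def)
qed

text \<open>A factor \<open>X\<close> known at the time of \<open>H\<close> can be moved past the
  conditional expectation, which replaces the event that \<open>J\<close> equals \<open>c\<close> by
  the conditional probability of \<open>c\<close>. Summing over \<open>c\<close> leaves the marginal
  probability of coordinate \<open>i\<close>.\<close>

lemma (in prob_space)
  fixes p :: "'a \<Rightarrow> 'd::finite \<Rightarrow> real" and J :: "'a \<Rightarrow> 'd \<Rightarrow> bool" and X :: "'a \<Rightarrow> real"
  assumes sub: "subalgebra M H"
    and J: "J \<in> M \<rightarrow>\<^sub>M count_space UNIV"
    and p [measurable]: "\<And>i. (\<lambda>\<omega>. p \<omega> i) \<in> borel_measurable M"
    and p01: "\<And>\<omega> i. 0 \<le> p \<omega> i \<and> p \<omega> i \<le> 1"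
    and law: "\<And>c. AE \<omega> in M. real_cond_exp M H (indicator {\<omega>\<in>space M. J \<omega> = c}) \<omega>
      = pmf (Pi_pmf UNIV False (\<lambda>i. bernoulli_pmf (p \<omega> i))) c"
    and X [measurable]: "X \<in> borel_measurable H" and X_int: "integrable M X"
  shows integrable_bernoulli_mult: "integrable M (\<lambda>\<omega>. of_bool (J \<omega> i) * X \<omega>)"
    and integral_bernoulli_mult:
      "(LINT \<omega>|M. of_bool (J \<omega> i) * X \<omega>) = (LINT \<omega>|M. p \<omega> i * X \<omega>)"
proof -
  interpret H: finite_measure_subalgebra M H using sub by unfold_locales
  have XM [measurable]: "X \<in> borel_measurable M" by (rule measurable_from_subalg[OF sub X])
  define E where "E = (\<lambda>c. {\<omega>\<in>space M. J \<omega> = c})"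
  define P where "P = (\<lambda>c \<omega>. pmf (Pi_pmf UNIV False (\<lambda>i. bernoulli_pmf (p \<omega> i))) c)"
  have E [measurable]: "E c \<in> sets M" for c
    using measurable_sets[OF J, of "{c}"] by (simp add: E_def vimage_def Int_def conj_commute)
  have P_meas [measurable]: "P c \<in> borel_measurable M" for c
  proof -
    \<comment> \<open>The explicit product formula for the mass function shows its measurability in
      the parameters.\<close>
    have "P c = (\<lambda>\<omega>. \<Prod>i\<in>UNIV. if c i then p \<omega> i else 1 - p \<omega> i)"
      unfolding P_def using p01 by (subst pmf_Pi') (auto intro!: ext prod.cong)
    then show ?thesis by simp
  qed
  have P_bound: "\<bar>P c \<omega>\<bar> \<le> 1" for c \<omega> by (simp add: P_def pmf_le_1)
  have E_int: "integrable M (\<lambda>\<omega>. indicator (E c) \<omega> * X \<omega>)" for c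
    by (rule integrable_bounded_mult[OF X_int, of _ 1]) (auto simp: indicator_def)
  have P_int: "integrable M (\<lambda>\<omega>. P c \<omega> * X \<omega>)" for c
    by (rule integrable_bounded_mult[OF X_int _ P_bound]) simp
  have E_eq: "(LINT \<omega>|M. indicator (E c) \<omega> * X \<omega>) = (LINT \<omega>|M. P c \<omega> * X \<omega>)" for c
  proof -
    have "(LINT \<omega>|M. indicator (E c) \<omega> * X \<omega>) = (LINT \<omega>|M. X \<omega> * real_cond_exp M H (indicator (E c)) \<omega>)"
      using E_int[of c] by (subst H.real_cond_exp_intg(2)) (auto simp: mult.commute)
    also have "\<dots> = (LINT \<omega>|M. P c \<omega> * X \<omega>)"
    proof (rule integral_cong_AE)
      show "AE \<omega> in M. X \<omega> * real_cond_exp M H (indicator (E c)) \<omega> = P c \<omega> * X \<omega>"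
        using law[of c] unfolding E_def P_def by eventually_elim simp
    qed (use measurable_from_subalg[OF sub borel_measurable_cond_exp] in measurable)
    finally show ?thesis .
  qed
  \<comment> \<open>The law is given for whole vectors \<open>c\<close>, so one coordinate is
    recovered by summing over all \<open>c\<close> for which \<open>c i\<close> holds.\<close>
  have J_sum: "of_bool (J \<omega> i) * X \<omega> = (\<Sum>c\<in>{c. c i}. indicator (E c) \<omega> * X \<omega>)" if "\<omega> \<in> space M" for \<omega>
  proof -
    have "(\<Sum>c\<in>{c. c i}. indicator (E c) \<omega>) = (\<Sum>c\<in>{c. c i}. if J \<omega> = c then 1 else 0 :: real)"
      using that by (intro sum.cong) (auto simp: E_def)
    then show ?thesis by (simp add: sum_distrib_right[symmetric])
  qed
  have P_sum: "p \<omega> i = (\<Sum>c\<in>{c. c i}. P c \<omega>)" for \<omega>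
  proof -
    let ?Q = "Pi_pmf UNIV False (\<lambda>i. bernoulli_pmf (p \<omega> i))"
    have "(\<Sum>c\<in>{c. c i}. P c \<omega>) = measure (measure_pmf ?Q) ((\<lambda>c. c i) -` {True})"
      by (simp add: P_def measure_measure_pmf_finite vimage_def)
    also have "\<dots> = measure (measure_pmf (map_pmf (\<lambda>c. c i) ?Q)) {True}" by simp
    also have "\<dots> = p \<omega> i"
      using p01 by (subst Pi_pmf_component) (simp_all add: measure_pmf_single)
    finally show ?thesis by simp
  qed
  show "integrable M (\<lambda>\<omega>. of_bool (J \<omega> i) * X \<omega>)"
    by (subst Bochner_Integration.integrable_cong[OF refl J_sum], assumption)
       (rule Bochner_Integration.integrable_sum, rule E_int)
  have "(LINT \<omega>|M. of_bool (J \<omega> i) * X \<omega>) = (LINT \<omega>|M. (\<Sum>c\<in>{c. c i}. indicator (E c) \<omega> * X \<omega>))"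
    by (rule Bochner_Integration.integral_cong[OF refl J_sum])
  also have "\<dots> = (LINT \<omega>|M. (\<Sum>c\<in>{c. c i}. P c \<omega> * X \<omega>))"
    by (simp only: Bochner_Integration.integral_sum E_int P_int E_eq)
  finally show "(LINT \<omega>|M. of_bool (J \<omega> i) * X \<omega>) = (LINT \<omega>|M. p \<omega> i * X \<omega>)"
    by (simp add: P_sum sum_distrib_right)
qed

section \<open>A single step of the algorithm\<close>

lemma move_prob_bounds:
  assumes "0 \<le> \<eta>" "0 \<le> a $ i" "0 < s (group_of \<G> i)"
  shows "0 \<le> move_prob \<G> s \<gamma> \<eta> a i" "move_prob \<G> s \<gamma> \<eta> a i \<le> 1"
  using assms score_nonneg[of \<G> \<gamma> a i] by (auto simp: move_prob_def)

text \<open>An infeasible coordinate has magnitude 0 and hence move probability 0, so every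
  coordinate that moves is feasible.\<close>

lemma qar_step_codes:
  fixes k k' :: "int^'d"
  assumes "k \<in> codes klo khi"
    and k': "k' = (\<chi> i. k $ i - sign (h $ i) * of_bool (J i))"
    and J: "\<And>i. J i \<Longrightarrow> move_prob \<G> s \<gamma> \<eta> (magnitude klo khi k h) i \<noteq> 0"
  shows "k' \<in> codes klo khi"
  unfolding codes_def
proof (intro CollectI allI)
  fix i
  show "k' $ i \<in> {klo $ i..khi $ i}"
  proof (cases "J i")
    case True
    then have "feasible klo khi k h i"
      using J[OF True] by (cases "feasible klo khi k h i") (simp_all add: move_prob_def magnitude_def)
    then show ?thesis using True by (simp add: k' feasible_def)
  qed (use assms(1) in \<open>simp add: k' codes_def\<close>)
qed

text \<open>Each displacement is a fixed amount times an indicator. An indicator is its own square,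
  so the quadratic term of the smoothness bound is linear in it as well and averages to a multiple
  of the move probability.\<close>

lemma smooth_step:
  fixes f :: "real^'d::finite \<Rightarrow> real" and \<G> :: "'d set set" and s :: "'d set \<Rightarrow> real"
  assumes smooth: "\<And>x y. f y \<le> f x + f' x \<bullet> (y - x) + 1 / 2 * (\<Sum>i\<in>UNIV. L $ i * (y $ i - x $ i)\<^sup>2)"
    and k': "k' = (\<chi> i. k $ i - sign (h $ i) * of_bool (J i))"
  defines "r \<equiv> \<lambda>i. s (group_of \<G> i)"
  shows "f (decode \<G> s k') \<le> f (decode \<G> s k) + (\<Sum>i\<in>UNIV. of_bool (J i) *
    (r i * (L $ i * r i / 2 * (of_int (sign (h $ i)))\<^sup>2 - f' (decode \<G> s k) $ i * of_int (sign (h $ i)))))"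
proof -
  let ?x = "decode \<G> s k" and ?y = "decode \<G> s k'"
  have d: "?y $ i - ?x $ i = - r i * of_int (sign (h $ i)) * of_bool (J i)" for i
    by (simp add: decode_def k' r_def algebra_simps)
  have "f ?y \<le> f ?x + (\<Sum>i\<in>UNIV. f' ?x $ i * (?y $ i - ?x $ i) + L $ i * (?y $ i - ?x $ i)\<^sup>2 / 2)"
    using smooth[of ?y ?x] by (simp add: inner_vec_def sum.distrib sum_divide_distrib)
  moreover have "f' ?x $ i * (?y $ i - ?x $ i) + L $ i * (?y $ i - ?x $ i)\<^sup>2 / 2 = of_bool (J i) *
      (r i * (L $ i * r i / 2 * (of_int (sign (h $ i)))\<^sup>2 - f' ?x $ i * of_int (sign (h $ i))))" for i
    unfolding d by (cases "J i") (simp_all add: power2_eq_square algebra_simps)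
  ultimately show ?thesis by simp
qed

text \<open>When the minimum in the move probability is not attained by 1 alone, the probability
  times the scale is \<open>\<eta> * a * b\<close> and the scale cancels. The square of a sign is at
  most 1 and \<open>L $ i\<close> is at most the group maximum, which gives the summand of
  \<open>route_drift_le\<close>.\<close>

lemma unclipped_move_le:
  fixes \<G> :: "'d::finite set set"
  assumes groups: "partition_on UNIV \<G>" and G: "G \<in> \<G>" "i \<in> G" and s: "s G > 0"
    and \<eta>: "\<eta> > 0" and a: "a $ i \<ge> 0"
    and unclipped: "\<eta> * a $ i * score \<G> \<gamma> a $ i \<le> s G"
    and L: "L $ i \<ge> 0"
  shows "move_prob \<G> s \<gamma> \<eta> a i *
      (s G * (L $ i * s G / 2 * (of_int (sign x))\<^sup>2 - v * of_int (sign x)))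
    \<le> \<eta> * (score \<G> \<gamma> a $ i * (group_max L G * s G / 2 * a $ i - v * (of_int (sign x) * a $ i)))"
proof -
  have "move_prob \<G> s \<gamma> \<eta> a i * s G = \<eta> * (score \<G> \<gamma> a $ i * a $ i)"
    using unclipped s by (simp add: move_prob_def group_of_eq[OF groups G] mult_ac)
  then have "move_prob \<G> s \<gamma> \<eta> a i * (s G * (L $ i * s G / 2 * (of_int (sign x))\<^sup>2 - v * of_int (sign x)))
      = \<eta> * (score \<G> \<gamma> a $ i * a $ i) * (L $ i * s G / 2 * (of_int (sign x))\<^sup>2 - v * of_int (sign x))"
    by (simp add: mult.assoc[symmetric])
  also have "\<dots> \<le> \<eta> * (score \<G> \<gamma> a $ i * a $ i) * (group_max L G * s G / 2 * 1 - v * of_int (sign x))"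
  proof (rule mult_left_mono[OF diff_right_mono])
    show "L $ i * s G / 2 * (of_int (sign x))\<^sup>2 \<le> group_max L G * s G / 2 * 1"
      using coord_le_group_max[OF G(2), of L] s L
      by (intro mult_mono divide_right_mono mult_right_mono) (auto simp: sign_def)
  qed (use \<eta> a score_nonneg[of \<G> \<gamma> a i] in simp)
  finally show ?thesis by (simp add: algebra_simps)
qed

text \<open>The first conclusion serves the induction that keeps the run in the codebook; the second
  is the descent used at each time. The descent averages over the indicators given \<open>H\<close>,
  and then over the gradient given \<open>F\<close>, separately for each value of the code.\<close>

lemma (in prob_space)
  fixes f :: "real^'d::finite \<Rightarrow> real"
  assumes L_nonneg: "\<And>i. L $ i \<ge> 0"
    and smooth: "\<And>x y. f y \<le> f x + f' x \<bullet> (y - x) + 1 / 2 * (\<Sum>i\<in>UNIV. L $ i * (y $ i - x $ i)\<^sup>2)"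
    and groups: "partition_on UNIV \<G>"
    and scale_pos: "\<And>G. G \<in> \<G> \<Longrightarrow> s G > 0"
    and sigma_nonneg: "\<And>i. \<sigma> $ i \<ge> 0"
    and n: "n \<ge> 1"
    and minibatch: "minibatch_gradient (codebook klo khi \<G> s) f' \<sigma> n \<nu>"
    and \<eta>: "\<eta> > 0"
    and F: "subalgebra M F" and H: "subalgebra M H" and FH: "subalgebra H F"
    and k [measurable]: "k \<in> F \<rightarrow>\<^sub>M count_space UNIV" and k'[measurable]: "k' \<in> M \<rightarrow>\<^sub>M count_space UNIV"
    and g [measurable]: "g \<in> H \<rightarrow>\<^sub>M borel" and J [measurable]: "J \<in> M \<rightarrow>\<^sub>M count_space UNIV"
    and g_law: "\<And>A. A \<in> sets borel \<Longrightarrow> AE \<omega> in M.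
      real_cond_exp M F (indicator {\<omega>\<in>space M. g \<omega> \<in> A}) \<omega> = measure (\<nu> (decode \<G> s (k \<omega>))) A"
    and J_law: "\<And>c. AE \<omega> in M. real_cond_exp M H (indicator {\<omega>\<in>space M. J \<omega> = c}) \<omega>
      = pmf (Pi_pmf UNIV False (\<lambda>i. bernoulli_pmf
          (move_prob \<G> s \<gamma> \<eta> (magnitude klo khi (k \<omega>) (g \<omega>)) i))) c"
    and step: "\<And>\<omega>. \<omega> \<in> space M \<Longrightarrow> k' \<omega> = (\<chi> i. k \<omega> $ i - sign (g \<omega> $ i) * of_bool (J \<omega> i))"
    and codes: "AE \<omega> in M. k \<omega> \<in> codes klo khi"
  shows qar_step_AE_codes: "AE \<omega> in M. k' \<omega> \<in> codes klo khi"
    and qar_step_descent: "(\<And>G i. G \<in> \<G> \<Longrightarrow> i \<in> G \<Longrightarrow>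
      AE \<omega> in M. let a = magnitude klo khi (k \<omega>) (g \<omega>) in \<eta> * a $ i * score \<G> \<gamma> a $ i \<le> s G) \<Longrightarrow>
     (LINT \<omega>|M. f (decode \<G> s (k' \<omega>))) \<le> (LINT \<omega>|M. f (decode \<G> s (k \<omega>)))
       + \<eta> * (1 / 8 * (\<Sum>G\<in>\<G>. real (card G) * (group_max L G * s G)\<^sup>2)
        + 1 / (2 * sqrt (real n)) * (\<Sum>G\<in>\<G>. group_max L G * s G * (\<Sum>i\<in>G. \<bar>\<sigma> $ i\<bar>))
        + (norm \<sigma>)\<^sup>2 / real n
        - 1 / 2 * (LINT \<omega>|M. (norm (feasible_grad klo khi (k \<omega>) (f' (decode \<G> s (k \<omega>)))))\<^sup>2)
        - (LINT \<omega>|M. route_gain klo khi \<G> s \<nu> \<gamma> L \<sigma> n (k \<omega>)))"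
proof -
  let ?C = "codes klo khi"
  define r where "r = (\<lambda>i. s (group_of \<G> i))"
  define p where "p = (\<lambda>\<omega> i. move_prob \<G> s \<gamma> \<eta> (magnitude klo khi (k \<omega>) (g \<omega>)) i)"
  have [measurable]: "k \<in> H \<rightarrow>\<^sub>M count_space UNIV" by (rule measurable_from_subalg[OF FH k])
  have kM [measurable]: "k \<in> M \<rightarrow>\<^sub>M count_space UNIV" by (rule measurable_from_subalg[OF F k])
  have gM [measurable]: "g \<in> M \<rightarrow>\<^sub>M borel" by (rule measurable_from_subalg[OF H g])
  have r: "0 < r i" for i unfolding r_def by (intro scale_pos group_of_mem groups)
  have p01: "0 \<le> p \<omega> i \<and> p \<omega> i \<le> 1" for \<omega> i
    unfolding p_def using \<eta> r unfolding r_def by (auto intro!: move_prob_bounds magnitude_nonneg)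
  have pH [measurable]: "(\<lambda>\<omega>. p \<omega> i) \<in> borel_measurable H" for i
  proof -
    \<comment> \<open>Measurability is checked at each fixed code; there are only countably
      many.\<close>
    have [measurable]: "(\<lambda>\<omega>. score \<G> \<gamma> (magnitude klo khi \<kappa> (g \<omega>)) $ i) \<in> borel_measurable H" for \<kappa>
      by (rule measurable_score) measurable
    show ?thesis
      unfolding p_def
      by (rule measurable_compose_countable[where f = "\<lambda>\<kappa> \<omega>. move_prob \<G> s \<gamma> \<eta> (magnitude klo khi \<kappa> (g \<omega>)) i"])
         (simp_all add: move_prob_def)
  qed
  have pM [measurable]: "(\<lambda>\<omega>. p \<omega> i) \<in> borel_measurable M" for i
    by (rule measurable_from_subalg[OF H pH])
  have J_law': "AE \<omega> in M. real_cond_exp M H (indicator {\<omega>\<in>space M. J \<omega> = c}) \<omega>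
      = pmf (Pi_pmf UNIV False (\<lambda>i. bernoulli_pmf (p \<omega> i))) c" for c
    unfolding p_def by (rule J_law)
  note bernoulli = integrable_bernoulli_mult[OF H J pM p01 J_law'] integral_bernoulli_mult[OF H J pM p01 J_law']
  have J_pos: "AE \<omega> in M. J \<omega> i \<longrightarrow> p \<omega> i \<noteq> 0" for i
  proof -
    \<comment> \<open>Testing the indicator against the event that its probability vanishes gives a
      nonnegative function with integral 0.\<close>
    let ?X = "\<lambda>\<omega>. of_bool (p \<omega> i = 0) :: real"
    have X: "?X \<in> borel_measurable H" unfolding of_bool_def by measurable
    have X_int: "integrable M ?X"
      by (rule integrable_const_bound[of _ 1]) (use measurable_from_subalg[OF H X] in auto)
    have "(LINT \<omega>|M. of_bool (J \<omega> i) * ?X \<omega>) = (LINT \<omega>|M. p \<omega> i * ?X \<omega>)"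
      by (rule bernoulli(2)[OF X X_int])
    also have "\<dots> = 0" by (simp add: of_bool_def if_distrib cong: if_cong)
    finally have "AE \<omega> in M. of_bool (J \<omega> i) * ?X \<omega> = 0"
      by (subst (asm) integral_nonneg_eq_0_iff_AE[OF bernoulli(1)[OF X X_int]]) auto
    then show ?thesis by eventually_elim auto
  qed
  have "AE \<omega> in M. \<forall>i. J \<omega> i \<longrightarrow> p \<omega> i \<noteq> 0" using J_pos by (subst AE_all_countable) blast
  then show codes': "AE \<omega> in M. k' \<omega> \<in> ?C"
    using codes AE_space
  proof eventually_elim
    case (elim \<omega>)
    then show ?case by (intro qar_step_codes[OF elim(2) step[OF elim(3)]]) (auto simp: p_def)
  qed

  assume unclipped: "\<And>G i. G \<in> \<G> \<Longrightarrow> i \<in> G \<Longrightarrow>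
      AE \<omega> in M. let a = magnitude klo khi (k \<omega>) (g \<omega>) in \<eta> * a $ i * score \<G> \<gamma> a $ i \<le> s G"
  define v where "v = (\<lambda>\<omega>. f' (decode \<G> s (k \<omega>)))"
  define X where "X = (\<lambda>i \<omega>. r i * (L $ i * r i / 2 * (of_int (sign (g \<omega> $ i)))\<^sup>2
    - v \<omega> $ i * of_int (sign (g \<omega> $ i))))"
  have XH [measurable]: "X i \<in> borel_measurable H" for i
    unfolding X_def v_def by measurable
  have X_int: "integrable M (X i)" for i
  proof (rule integrable_const_bound)
    \<comment> \<open>The code lies almost surely in a finite set, so summing over that set gives a
      crude uniform bound on the gradient entry.\<close>
    show "AE \<omega> in M. norm (X i \<omega>) \<le> r i * (L $ i * r i / 2 + (\<Sum>\<kappa>\<in>?C. \<bar>f' (decode \<G> s \<kappa>) $ i\<bar>))"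
      using codes
    proof eventually_elim
      case (elim \<omega>)
      have "\<bar>v \<omega> $ i\<bar> \<le> (\<Sum>\<kappa>\<in>?C. \<bar>f' (decode \<G> s \<kappa>) $ i\<bar>)"
        unfolding v_def by (rule member_le_sum[OF elim]) (auto simp: finite_codes)
      moreover have "0 \<le> L $ i * r i / 2" using L_nonneg[of i] r[of i] by simp
      ultimately have "\<bar>L $ i * r i / 2 * (of_int (sign (g \<omega> $ i)))\<^sup>2 - v \<omega> $ i * of_int (sign (g \<omega> $ i))\<bar>
          \<le> L $ i * r i / 2 + (\<Sum>\<kappa>\<in>?C. \<bar>f' (decode \<G> s \<kappa>) $ i\<bar>)"
        by (auto simp: sign_def)
      then show ?case using r[of i] unfolding X_def by (simp add: abs_mult)
    qed
  qed (rule measurable_from_subalg[OF H XH])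
  have pX_int: "integrable M (\<lambda>\<omega>. p \<omega> i * X i \<omega>)" for i
    by (rule integrable_bounded_mult[OF X_int pM, where B = 1]) (use p01 in simp)
  \<comment> \<open>\<open>\<Psi>\<close> is the drift integrand and \<open>B\<close> its bound from
    \<open>route_drift_le\<close>, both as functions of a fixed code so that the fibre lemmas
    apply.\<close>
  define \<Psi> where "\<Psi> = (\<lambda>\<kappa> h. \<Sum>G\<in>\<G>. \<Sum>i\<in>G. score \<G> \<gamma> (magnitude klo khi \<kappa> h) $ i *
    (group_max L G * s G / 2 * magnitude klo khi \<kappa> h $ i
      - f' (decode \<G> s \<kappa>) $ i * (of_int (sign (h $ i)) * magnitude klo khi \<kappa> h $ i)))"
  define B where "B = (\<lambda>\<kappa>. 1 / 8 * (\<Sum>G\<in>\<G>. real (card G) * (group_max L G * s G)\<^sup>2)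
        + 1 / (2 * sqrt (real n)) * (\<Sum>G\<in>\<G>. group_max L G * s G * (\<Sum>i\<in>G. \<bar>\<sigma> $ i\<bar>))
        + (norm \<sigma>)\<^sup>2 / real n
        - 1 / 2 * (norm (feasible_grad klo khi \<kappa> (f' (decode \<G> s \<kappa>))))\<^sup>2
        - route_gain klo khi \<G> s \<nu> \<gamma> L \<sigma> n \<kappa>)"
  let ?E = "\<lambda>\<kappa>. {\<omega>\<in>space M. k \<omega> = \<kappa>}"
  have \<nu>: "prob_space (\<nu> (decode \<G> s \<kappa>))" "sets (\<nu> (decode \<G> s \<kappa>)) = sets borel" if "\<kappa> \<in> ?C" for \<kappa>
    using minibatch that unfolding minibatch_gradient_def codebook_def by auto
  note drift = route_drift_le[OF minibatch _ groups scale_pos L_nonneg sigma_nonneg n, of _ \<gamma>]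
  have \<Psi>_int: "integrable (\<nu> (decode \<G> s \<kappa>)) (\<Psi> \<kappa>)"
    and \<Psi>_le: "integral\<^sup>L (\<nu> (decode \<G> s \<kappa>)) (\<Psi> \<kappa>) \<le> B \<kappa>" if "\<kappa> \<in> ?C" for \<kappa>
    using drift[OF that] unfolding \<Psi>_def B_def by auto
  note fibre_int = integrable_on_fibre[OF F k gM g_law \<nu>]
    and fibre = integral_on_fibre[OF F k gM g_law \<nu>]
  have pX_le: "AE \<omega> in M. (\<Sum>i\<in>UNIV. p \<omega> i * X i \<omega>) \<le> \<eta> * (\<Sum>\<kappa>\<in>?C. indicator (?E \<kappa>) \<omega> * \<Psi> \<kappa> (g \<omega>))"
  proof -
    have "AE \<omega> in M. \<forall>i. let a = magnitude klo khi (k \<omega>) (g \<omega>) in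
        \<eta> * a $ i * score \<G> \<gamma> a $ i \<le> s (group_of \<G> i)"
      by (subst AE_all_countable) (intro allI unclipped group_of_mem groups)
    then show ?thesis using codes AE_space
    proof eventually_elim
      case (elim \<omega>)
      have "(\<Sum>i\<in>UNIV. p \<omega> i * X i \<omega>) = (\<Sum>G\<in>\<G>. \<Sum>i\<in>G. p \<omega> i * X i \<omega>)"
        by (simp add: sum_sum_groups[OF groups])
      also have "\<dots> \<le> (\<Sum>G\<in>\<G>. \<Sum>i\<in>G. \<eta> * (score \<G> \<gamma> (magnitude klo khi (k \<omega>) (g \<omega>)) $ i *
          (group_max L G * s G / 2 * magnitude klo khi (k \<omega>) (g \<omega>) $ i
          - f' (decode \<G> s (k \<omega>)) $ i * (of_int (sign (g \<omega> $ i)) * magnitude klo khi (k \<omega>) (g \<omega>) $ i))))"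
      proof (intro sum_mono)
        fix G i assume G: "G \<in> \<G>" "i \<in> G"
        have "\<eta> * magnitude klo khi (k \<omega>) (g \<omega>) $ i * score \<G> \<gamma> (magnitude klo khi (k \<omega>) (g \<omega>)) $ i \<le> s G"
          using elim(1) group_of_eq[OF groups G] by (metis (mono_tags, lifting))
        from unclipped_move_le[where s = s and L = L and a = "magnitude klo khi (k \<omega>) (g \<omega>)", OF groups G scale_pos[OF G(1)] \<eta> magnitude_nonneg this L_nonneg]
        show "p \<omega> i * X i \<omega> \<le> \<eta> * (score \<G> \<gamma> (magnitude klo khi (k \<omega>) (g \<omega>)) $ i *
          (group_max L G * s G / 2 * magnitude klo khi (k \<omega>) (g \<omega>) $ i
          - f' (decode \<G> s (k \<omega>)) $ i * (of_int (sign (g \<omega> $ i)) * magnitude klo khi (k \<omega>) (g \<omega>) $ i)))"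
          unfolding p_def X_def r_def v_def group_of_eq[OF groups G] .
      qed
      also have "\<dots> = \<eta> * \<Psi> (k \<omega>) (g \<omega>)" by (simp add: \<Psi>_def sum_distrib_left)
      \<comment> \<open>The current code is one of the finitely many codes, so exactly one term
        survives; the random code is thereby replaced by fixed ones.\<close>
      also have "\<Psi> (k \<omega>) (g \<omega>) = (\<Sum>\<kappa>\<in>?C. if \<kappa> = k \<omega> then \<Psi> \<kappa> (g \<omega>) else 0)"
        using elim(2) by (simp add: finite_codes)
      also have "\<dots> = (\<Sum>\<kappa>\<in>?C. indicator (?E \<kappa>) \<omega> * \<Psi> \<kappa> (g \<omega>))"
        using elim(3) by (intro sum.cong) (auto simp: indicator_def)
      finally show ?case .
    qed
  qed
  \<comment> \<open>The same decomposition, used in the opposite direction for the bound.\<close>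
  have B_fibre: "(\<Sum>\<kappa>\<in>?C. prob (?E \<kappa>) * B \<kappa>) = (LINT \<omega>|M. B (k \<omega>))"
  proof -
    have [measurable]: "?E \<kappa> \<in> sets M" for \<kappa> by measurable
    have "(\<Sum>\<kappa>\<in>?C. prob (?E \<kappa>) * B \<kappa>) = (LINT \<omega>|M. (\<Sum>\<kappa>\<in>?C. indicator (?E \<kappa>) \<omega> * B \<kappa>))"
      by (simp add: less_top[symmetric])
    also have "\<dots> = (LINT \<omega>|M. B (k \<omega>))"
    proof (rule integral_cong_AE)
      show "AE \<omega> in M. (\<Sum>\<kappa>\<in>?C. indicator (?E \<kappa>) \<omega> * B \<kappa>) = B (k \<omega>)"
        using codes AE_space
      proof eventually_elim
        case (elim \<omega>)
        have "(\<Sum>\<kappa>\<in>?C. indicator (?E \<kappa>) \<omega> * B \<kappa>) = (\<Sum>\<kappa>\<in>?C. if \<kappa> = k \<omega> then B \<kappa> else 0)"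
          using elim(2) by (intro sum.cong) (auto simp: indicator_def)
        then show ?case using elim(1) by (simp add: finite_codes)
      qed
    qed measurable
    finally show ?thesis .
  qed
  note fin = integrable_finite_valued[OF kM codes finite_codes]
  have "(LINT \<omega>|M. f (decode \<G> s (k' \<omega>)))
      \<le> (LINT \<omega>|M. f (decode \<G> s (k \<omega>)) + (\<Sum>i\<in>UNIV. of_bool (J \<omega> i) * X i \<omega>))"
  proof (rule integral_mono_AE)
    show "integrable M (\<lambda>\<omega>. f (decode \<G> s (k' \<omega>)))"
      by (rule integrable_finite_valued[OF k' codes' finite_codes])
    show "integrable M (\<lambda>\<omega>. f (decode \<G> s (k \<omega>)) + (\<Sum>i\<in>UNIV. of_bool (J \<omega> i) * X i \<omega>))"
      by (intro Bochner_Integration.integrable_add Bochner_Integration.integrable_sum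
          bernoulli(1)[OF XH X_int] fin)
    show "AE \<omega> in M. f (decode \<G> s (k' \<omega>))
        \<le> f (decode \<G> s (k \<omega>)) + (\<Sum>i\<in>UNIV. of_bool (J \<omega> i) * X i \<omega>)"
      using AE_space
    proof eventually_elim
      case (elim \<omega>)
      show ?case
        unfolding X_def r_def v_def using smooth_step[OF smooth step[OF elim]] .
    qed
  qed
  also have "\<dots> = (LINT \<omega>|M. f (decode \<G> s (k \<omega>))) + (\<Sum>i\<in>UNIV. LINT \<omega>|M. of_bool (J \<omega> i) * X i \<omega>)"
    by (simp only: Bochner_Integration.integral_add Bochner_Integration.integral_sum
        Bochner_Integration.integrable_sum bernoulli(1)[OF XH X_int]
        fin[of "\<lambda>\<kappa>. f (decode \<G> s \<kappa>)"])
  also have "(\<Sum>i\<in>UNIV. LINT \<omega>|M. of_bool (J \<omega> i) * X i \<omega>) = (\<Sum>i\<in>UNIV. LINT \<omega>|M. p \<omega> i * X i \<omega>)"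
    by (simp only: bernoulli(2)[OF XH X_int])
  also have "\<dots> = (LINT \<omega>|M. (\<Sum>i\<in>UNIV. p \<omega> i * X i \<omega>))"
    by (intro Bochner_Integration.integral_sum[symmetric] pX_int)
  also have "\<dots> \<le> (LINT \<omega>|M. \<eta> * (\<Sum>\<kappa>\<in>?C. indicator (?E \<kappa>) \<omega> * \<Psi> \<kappa> (g \<omega>)))"
  proof (rule integral_mono_AE[OF _ _ pX_le])
    show "integrable M (\<lambda>\<omega>. \<Sum>i\<in>UNIV. p \<omega> i * X i \<omega>)"
      by (intro Bochner_Integration.integrable_sum pX_int)
    show "integrable M (\<lambda>\<omega>. \<eta> * (\<Sum>\<kappa>\<in>?C. indicator (?E \<kappa>) \<omega> * \<Psi> \<kappa> (g \<omega>)))"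
      by (intro integrable_mult_right Bochner_Integration.integrable_sum fibre_int \<Psi>_int)
  qed
  also have "\<dots> = \<eta> * (\<Sum>\<kappa>\<in>?C. LINT \<omega>|M. indicator (?E \<kappa>) \<omega> * \<Psi> \<kappa> (g \<omega>))"
    by (subst integral_mult_right_zero, subst Bochner_Integration.integral_sum)
       (auto intro: fibre_int \<Psi>_int)
  also have "\<dots> = \<eta> * (\<Sum>\<kappa>\<in>?C. prob (?E \<kappa>) * integral\<^sup>L (\<nu> (decode \<G> s \<kappa>)) (\<Psi> \<kappa>))"
    by (intro arg_cong2[where f = "(*)"] sum.cong refl fibre \<Psi>_int)
  also have "\<dots> \<le> \<eta> * (\<Sum>\<kappa>\<in>?C. prob (?E \<kappa>) * B \<kappa>)"
    using \<eta> by (intro mult_left_mono sum_mono \<Psi>_le) auto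
  also have "\<dots> = \<eta> * (LINT \<omega>|M. B (k \<omega>))" by (simp only: B_fibre)
  also have "(LINT \<omega>|M. B (k \<omega>)) = 1 / 8 * (\<Sum>G\<in>\<G>. real (card G) * (group_max L G * s G)\<^sup>2)
        + 1 / (2 * sqrt (real n)) * (\<Sum>G\<in>\<G>. group_max L G * s G * (\<Sum>i\<in>G. \<bar>\<sigma> $ i\<bar>))
        + (norm \<sigma>)\<^sup>2 / real n
        - 1 / 2 * (LINT \<omega>|M. (norm (feasible_grad klo khi (k \<omega>) (f' (decode \<G> s (k \<omega>)))))\<^sup>2)
        - (LINT \<omega>|M. route_gain klo khi \<G> s \<nu> \<gamma> L \<sigma> n (k \<omega>))"
    unfolding B_def
    by (subst Bochner_Integration.integral_diff, intro fin, intro fin)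
       (subst Bochner_Integration.integral_diff, intro fin, intro fin, simp add: prob_space)
  finally show "(LINT \<omega>|M. f (decode \<G> s (k' \<omega>))) \<le> (LINT \<omega>|M. f (decode \<G> s (k \<omega>)))
       + \<eta> * (1 / 8 * (\<Sum>G\<in>\<G>. real (card G) * (group_max L G * s G)\<^sup>2)
        + 1 / (2 * sqrt (real n)) * (\<Sum>G\<in>\<G>. group_max L G * s G * (\<Sum>i\<in>G. \<bar>\<sigma> $ i\<bar>))
        + (norm \<sigma>)\<^sup>2 / real n
        - 1 / 2 * (LINT \<omega>|M. (norm (feasible_grad klo khi (k \<omega>) (f' (decode \<G> s (k \<omega>)))))\<^sup>2)
        - (LINT \<omega>|M. route_gain klo khi \<G> s \<nu> \<gamma> L \<sigma> n (k \<omega>)))"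
    by simp
qed

section \<open>Telescoping along the run\<close>

theorem theorem11:
  fixes f :: "real^'d::finite \<Rightarrow> real" and f' :: "real^'d \<Rightarrow> real^'d"
    and L \<sigma> :: "real^'d"
    and klo khi k0 :: "int^'d"
    and \<G> :: "'d set set" and s :: "'d set \<Rightarrow> real"
    and \<nu> :: "real^'d \<Rightarrow> (real^'d) measure"
    and n T :: nat and \<gamma> \<eta> :: real
    and M :: "'w measure" and F H :: "nat \<Rightarrow> 'w measure"
    and k :: "nat \<Rightarrow> 'w \<Rightarrow> int^'d" and g :: "nat \<Rightarrow> 'w \<Rightarrow> real^'d"
    and J :: "nat \<Rightarrow> 'w \<Rightarrow> 'd \<Rightarrow> bool"
  assumes gradient: "\<And>x. GDERIV f x :> f' x"
    and L_nonneg: "\<And>i. L $ i \<ge> 0"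
    and smooth: "\<And>x y. f y \<le> f x + f' x \<bullet> (y - x) + 1 / 2 * (\<Sum>i\<in>UNIV. L $ i * (y $ i - x $ i)\<^sup>2)"
    and code_bounds: "\<And>i. klo $ i \<le> khi $ i"
    and groups: "partition_on UNIV \<G>"
    and scale_pos: "\<And>G. G \<in> \<G> \<Longrightarrow> s G > 0"
    and sigma_nonneg: "\<And>i. \<sigma> $ i \<ge> 0"
    and batch_size: "n \<ge> 1"
    and minibatch: "minibatch_gradient (codebook klo khi \<G> s) f' \<sigma> n \<nu>"
    and params: "\<gamma> \<ge> 0" "\<eta> > 0" "T \<ge> 1"
    and start: "k0 \<in> codes klo khi"
    and run: "qar_run klo khi \<G> s \<nu> \<gamma> \<eta> k0 T M F H k g J"
    and no_clipping: "\<And>t G i. t < T \<Longrightarrow> G \<in> \<G> \<Longrightarrow> i \<in> G \<Longrightarrow>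
      AE \<omega> in M. let a = magnitude klo khi (k t \<omega>) (g t \<omega>) in \<eta> * a $ i * score \<G> \<gamma> a $ i \<le> s G"
  shows "1 / real T * (\<Sum>t<T. LINT \<omega>|M.
             (norm (feasible_grad klo khi (k t \<omega>) (f' (decode \<G> s (k t \<omega>)))))\<^sup>2)
         \<le> 2 * (f (decode \<G> s k0) - Min (f ` codebook klo khi \<G> s)) / (\<eta> * real T)
           + 1 / 4 * (\<Sum>G\<in>\<G>. real (card G) * (group_max L G)\<^sup>2 * (s G)\<^sup>2)
           + 1 / sqrt (real n) * (\<Sum>G\<in>\<G>. group_max L G * s G * (\<Sum>i\<in>G. \<bar>\<sigma> $ i\<bar>))
           + 2 * (norm \<sigma>)\<^sup>2 / real n
           - 2 / real T * (\<Sum>t<T. LINT \<omega>|M. route_gain klo khi \<G> s \<nu> \<gamma> L \<sigma> n (k t \<omega>))"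
proof -
  let ?C = "codes klo khi"
  interpret prob_space M using run by (simp add: qar_run_def)
  have F: "subalgebra M (F t)" "k t \<in> F t \<rightarrow>\<^sub>M count_space UNIV" if "t \<le> T" for t
    using run that unfolding qar_run_def by auto
  have H: "subalgebra M (H t)" "subalgebra (H t) (F t)" "g t \<in> H t \<rightarrow>\<^sub>M borel"
    and J: "J t \<in> F (Suc t) \<rightarrow>\<^sub>M count_space UNIV" if "t < T" for t
    using run that unfolding qar_run_def by auto
  have k0: "k 0 \<omega> = k0" if "\<omega> \<in> space M" for \<omega>
    using run that unfolding qar_run_def by auto
  have g_law: "AE \<omega> in M. real_cond_exp M (F t) (indicator {\<omega>\<in>space M. g t \<omega> \<in> A}) \<omega>
      = measure (\<nu> (decode \<G> s (k t \<omega>))) A" if "t < T" "A \<in> sets borel" for t A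
    using run that unfolding qar_run_def by auto
  have J_law: "AE \<omega> in M. real_cond_exp M (H t) (indicator {\<omega>\<in>space M. J t \<omega> = c}) \<omega>
      = pmf (Pi_pmf UNIV False (\<lambda>i. bernoulli_pmf
          (move_prob \<G> s \<gamma> \<eta> (magnitude klo khi (k t \<omega>) (g t \<omega>)) i))) c" if "t < T" for t c
    using run that unfolding qar_run_def by auto
  have step: "k (Suc t) \<omega> = (\<chi> i. k t \<omega> $ i - sign (g t \<omega> $ i) * of_bool (J t \<omega> i))"
    if "t < T" "\<omega> \<in> space M" for t \<omega>
    using run that unfolding qar_run_def by auto
  have kM: "k t \<in> M \<rightarrow>\<^sub>M count_space UNIV" if "t \<le> T" for t
    using measurable_from_subalg[OF F[OF that]] .
  have JM: "J t \<in> M \<rightarrow>\<^sub>M count_space UNIV" if "t < T" for t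
    using measurable_from_subalg[OF F(1) J] that by simp
  \<comment> \<open>This comes first because the gradient law is controlled only at endpoints in the
    codebook, and integrability rests on the finiteness of the set of codes.\<close>
  have codes: "AE \<omega> in M. k t \<omega> \<in> ?C" if "t \<le> T" for t
    using that
  proof (induction t)
    case 0
    show ?case using start by (intro AE_I2) (simp add: k0)
  next
    case (Suc t)
    then have t: "t < T" "t \<le> T" by auto
    show ?case
      by (rule qar_step_AE_codes[OF L_nonneg smooth groups scale_pos sigma_nonneg batch_size minibatch
            params(2) F(1)[OF t(2)] H(1,2)[OF t(1)] F(2)[OF t(2)] kM[OF Suc.prems] H(3)[OF t(1)]
            JM[OF t(1)] g_law[OF t(1)] J_law[OF t(1)] step[OF t(1)] Suc.IH[OF t(2)]])
  qed
  define D where "D = (\<lambda>t. LINT \<omega>|M. f (decode \<G> s (k t \<omega>)))"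
  define A where "A = (\<lambda>t. LINT \<omega>|M. (norm (feasible_grad klo khi (k t \<omega>) (f' (decode \<G> s (k t \<omega>)))))\<^sup>2)"
  define R where "R = (\<lambda>t. LINT \<omega>|M. route_gain klo khi \<G> s \<nu> \<gamma> L \<sigma> n (k t \<omega>))"
  define c1 where "c1 = (\<Sum>G\<in>\<G>. real (card G) * (group_max L G)\<^sup>2 * (s G)\<^sup>2)"
  define c2 where "c2 = (\<Sum>G\<in>\<G>. group_max L G * s G * (\<Sum>i\<in>G. \<bar>\<sigma> $ i\<bar>))"
  define m where "m = Min (f ` codebook klo khi \<G> s)"
  \<comment> \<open>Half of the constant terms of the claim: the descent has \<open>1 / 2\<close> in
    front of the gradient norm, and doubling restores them.\<close>
  define c where "c = 1 / 8 * c1 + 1 / (2 * sqrt (real n)) * c2 + (norm \<sigma>)\<^sup>2 / real n"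
  have c_eq: "c = 1 / 8 * (\<Sum>G\<in>\<G>. real (card G) * (group_max L G * s G)\<^sup>2)
      + 1 / (2 * sqrt (real n)) * (\<Sum>G\<in>\<G>. group_max L G * s G * (\<Sum>i\<in>G. \<bar>\<sigma> $ i\<bar>))
      + (norm \<sigma>)\<^sup>2 / real n"
    by (simp add: c_def c1_def c2_def power_mult_distrib mult.assoc)
  have "D (Suc t) \<le> D t + \<eta> * (c - 1 / 2 * A t - R t)" if t: "t < T" for t
  proof -
    have t': "t \<le> T" "Suc t \<le> T" using t by auto
    show ?thesis
      unfolding D_def A_def R_def c_eq
      by (rule qar_step_descent[OF L_nonneg smooth groups scale_pos sigma_nonneg batch_size minibatch
          params(2) F(1)[OF t'(1)] H(1,2)[OF t] F(2)[OF t'(1)] kM[OF t'(2)] H(3)[OF t]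
          JM[OF t] g_law[OF t] J_law[OF t] step[OF t] codes[OF t'(1)]])
         (assumption | rule no_clipping[OF t])+
  qed
  then have "(\<Sum>t<T. D (Suc t) - D t) \<le> (\<Sum>t<T. \<eta> * (c - 1 / 2 * A t - R t))"
    by (intro sum_mono) (simp add: algebra_simps)
  then have telescoped: "D T - D 0 \<le> \<eta> * (real T * c - 1 / 2 * (\<Sum>t<T. A t) - (\<Sum>t<T. R t))"
    unfolding sum_lessThan_telescope
    by (simp add: sum_distrib_left[symmetric] sum_subtractf sum_divide_distrib)
  have "D 0 = (LINT \<omega>|M. f (decode \<G> s k0))"
    unfolding D_def by (intro Bochner_Integration.integral_cong) (auto simp: k0)
  then have D0: "D 0 = f (decode \<G> s k0)" by (simp add: prob_space)
  \<comment> \<open>The last code lies almost surely in the codebook, so the mean of its objective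
    value is at least the minimum.\<close>
  have "m = (LINT \<omega>|M. m)" by (simp add: prob_space)
  also have "\<dots> \<le> D T"
    unfolding D_def
  proof (rule integral_mono_AE)
    show "integrable M (\<lambda>\<omega>. f (decode \<G> s (k T \<omega>)))"
      by (rule integrable_finite_valued[OF kM[OF order_refl] codes[OF order_refl] finite_codes])
    show "AE \<omega> in M. m \<le> f (decode \<G> s (k T \<omega>))"
      using codes[of T] by (auto simp: m_def codebook_def finite_codes intro!: Min_le)
  qed simp
  finally have "m - f (decode \<G> s k0) \<le> \<eta> * (real T * c - 1 / 2 * (\<Sum>t<T. A t) - (\<Sum>t<T. R t))"
    using telescoped D0 by simp
  then have "\<eta> * (\<Sum>t<T. A t)
      \<le> 2 * (f (decode \<G> s k0) - m) + \<eta> * real T * (2 * c) - 2 * \<eta> * (\<Sum>t<T. R t)"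
    by (simp add: algebra_simps)
  then have "\<eta> * (\<Sum>t<T. A t) / (\<eta> * real T)
      \<le> (2 * (f (decode \<G> s k0) - m) + \<eta> * real T * (2 * c) - 2 * \<eta> * (\<Sum>t<T. R t)) / (\<eta> * real T)"
    by (rule divide_right_mono) (use params in simp)
  then have "1 / real T * (\<Sum>t<T. A t)
      \<le> 2 * (f (decode \<G> s k0) - m) / (\<eta> * real T) + 2 * c - 2 / real T * (\<Sum>t<T. R t)"
    using params by (simp add: add_divide_distrib diff_divide_distrib)
  moreover have "2 * c = 1 / 4 * c1 + 1 / sqrt (real n) * c2 + 2 * (norm \<sigma>)\<^sup>2 / real n"
    by (simp add: c_def)
  ultimately show ?thesis
    unfolding A_def[symmetric] R_def[symmetric] c1_def[symmetric] c2_def[symmetric] m_def[symmetric]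
    by linarith
qed

end
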